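(* Let $N\ge 2$ be an integer, let $V>g>0$ be real numbers, and let $r_1,r_2\in[0,1]$ with at least one of $r_1,r_2$ nonzero. Let $p^*=\left(\frac{r_1g}{V-g+r_1g}\right)^{\frac{1}{N-1}}$. Under the symmetric mixed-strategy Nash equilibrium of the auction game: (1) The expected revenue from the auction is $$\mathbb E[\mathsf{Revenue}]=\bigl(1-(p^* )^N\bigr)V=\left(1-\left(\frac{r_1g}{V-g+r_1g}\right)^{\frac{N}{N-1}}\right)V.$$ (2) As a function of one parameter with the others fixed, expected revenue decreases in $r_1$, does not depend on $N$ when $r_1=0$, decreases in $N$ when $r_1\ne0$, and does not depend on $r_2$. (3) Expected revenue decomposes as the sum of the revenue from base fees and the revenue from priority fees, which are given by $$\mathbb E[\mathsf{BaseRevenue}]=\bigl(1-(p^* )^N\bigr)g+\Bigl((1-p^* )N-\bigl(1-(p^* )^N\bigr)\Bigr)r_1g,$$ $$\mathbb E[\mathsf{PriorityRevenue}]=\bigl(1-(p^* )^N\bigr)(V-g)-\Bigl((1-p^* )N-\bigl(1-(p^* )^N\bigr)\Bigr)r_1g.$$ (4) If $r_1\ne0$, then as $N\to\infty$ (with the other parameters fixed), $$\lim_{N\to\infty}\mathbb E[\mathsf{Revenue}]=\frac{V(V-g)}{V-g+r_1g},$$ $$\lim_{N\to\infty}\mathbb E[\mathsf{BaseRevenue}]=\frac{(V-g)(g-r_1g)}{V-g+r_1g}+r_1g\log\left(1+\frac{V-g}{r_1g}\right),$$ $$\lim_{N\to\infty}\mathbb E[\mathsf{PriorityRevenue}]=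(V-g)-r_1g\log\left(1+\frac{V-g}{r_1g}\right).$$
   Context: Auction game. $N\ge2$ agents compete for a single opportunity of common value $V>0$; $g>0$ is the base fee, with $V>g$; $r_1,r_2\in[0,1]$ are the revert penalty rates on the base fee and the priority fee. Each agent either abstains or submits a priority-fee bid $b_i\ge0$. The highest participating bidder $w$ wins, receives value $V$ and pays $g+b_w$; every other participating agent $j$ receives no value and pays $r_1g+r_2b_j$; abstaining agents receive and pay nothing. A mixed strategy is a pair $(p,F)$: abstain with probability $p\in[0,1]$, otherwise draw the bid from the continuous cdf $F$ on $[0,\infty)$; agents randomize independently (so ties have probability zero) and maximize expected payoff (value received minus payment). When at least one of $r_1,r_2$ is nonzero, the (unique) symmetric mixed-strategy Nash equilibrium is the profile in which every agent uses $(p^*,F^* )$, with $p^*$ as in the claim and $$F^*(b)=\frac{1}{1-p^*}\left(\left(\frac{r_1g+r_2b}{V-g-b+r_1g+r_2b}\right)^{\frac1{N-1}}-p^*\right),\quad b\in[0,V-g].$$ Revenue. For a realization of the mixed strategies in which at least one agent participates, with winner $w$ and set $L$ of losing participants: $\mathsf{BaseRevenue}=g+|L|\,r_1g$, $\mathsf{PriorityRevenue}=b_w+r_2\sum_{j\in L}b_j$; if nobody participates both are $0$. $\mathsf{Revenue}=\mathsf{BaseRevenue}+\mathsf{PriorityRevenue}$. Expectations are over the equilibrium randomization. *)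

theory Defs
  imports "HOL-Probability.Probability"
begin

text \<open>
  Agents are the numbers below \<open>N\<close>. An action is \<open>None\<close> (abstain) or \<open>Some b\<close> (bid \<open>b\<close>);
  an action profile is a function on agents of which only the values below \<open>N\<close> matter.
\<close>

definition participants :: "nat \<Rightarrow> (nat \<Rightarrow> real option) \<Rightarrow> nat set" where
  "participants N a = {i. i < N \<and> a i \<noteq> None}"

definition bid :: "(nat \<Rightarrow> real option) \<Rightarrow> nat \<Rightarrow> real" where
  "bid a i = the (a i)"

text \<open>
  Ties go to the smallest index, so that there is exactly one winner whenever somebody
  participates; with the atomless bid distributions below this choice affects only a null set.
\<close>

definition winner :: "nat \<Rightarrow> (nat \<Rightarrow> real option) \<Rightarrow> nat" where
  "winner N a =
     (LEAST i. i \<in> participants N a \<and> (\<forall>j\<in>participants N a. bid a j \<le> bid a i))"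

definition losers :: "nat \<Rightarrow> (nat \<Rightarrow> real option) \<Rightarrow> nat set" where
  "losers N a = participants N a - {winner N a}"

definition payoff ::
  "nat \<Rightarrow> real \<Rightarrow> real \<Rightarrow> real \<Rightarrow> real \<Rightarrow> (nat \<Rightarrow> real option) \<Rightarrow> nat \<Rightarrow> real" where
  "payoff N V g r1 r2 a i =
     (if i \<notin> participants N a then 0
      else if i = winner N a then V - (g + bid a i)
      else - (r1 * g + r2 * bid a i))"

definition base_revenue :: "nat \<Rightarrow> real \<Rightarrow> real \<Rightarrow> (nat \<Rightarrow> real option) \<Rightarrow> real" where
  "base_revenue N g r1 a =
     (if participants N a = {} then 0
      else g + real (card (losers N a)) * (r1 * g))"

definition priority_revenue :: "nat \<Rightarrow> real \<Rightarrow> (nat \<Rightarrow> real option) \<Rightarrow> real" where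
  "priority_revenue N r2 a =
     (if participants N a = {} then 0
      else bid a (winner N a) + r2 * (\<Sum>j\<in>losers N a. bid a j))"

definition revenue ::
  "nat \<Rightarrow> real \<Rightarrow> real \<Rightarrow> real \<Rightarrow> (nat \<Rightarrow> real option) \<Rightarrow> real" where
  "revenue N g r1 r2 a = base_revenue N g r1 a + priority_revenue N r2 a"

text \<open>
  A mixed strategy is a pair \<open>(p, F)\<close>. The cdf \<open>F\<close> of a law on the nonnegative reals is
  represented as a function on all of the reals; continuity on the whole line rules out an atom
  at \<open>0\<close> as well.
\<close>

type_synonym strategy = "real \<times> (real \<Rightarrow> real)"

definition mixed_strategy :: "strategy \<Rightarrow> bool" where
  "mixed_strategy s \<longleftrightarrow> (case s of (p, F) \<Rightarrow>
     0 \<le> p \<and> p \<le> 1 \<and>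
     mono F \<and> continuous_on UNIV F \<and> (\<forall>b\<le>0. F b = 0) \<and> (F \<longlongrightarrow> 1) at_top)"

text \<open>
  A strategy is played by drawing independently a coin, which says \<open>True\<close> (participate) with
  probability \<open>1 - p\<close>, and a bid with cdf \<open>F\<close>; the bid is discarded on \<open>False\<close>.
\<close>

definition draw :: "strategy \<Rightarrow> (bool \<times> real) measure" where
  "draw s = (case s of (p, F) \<Rightarrow>
     measure_pmf (bernoulli_pmf (1 - p)) \<Otimes>\<^sub>M interval_measure F)"

definition draws :: "nat \<Rightarrow> (nat \<Rightarrow> strategy) \<Rightarrow> (nat \<Rightarrow> bool \<times> real) measure" where
  "draws N \<sigma> = (\<Pi>\<^sub>M i\<in>{..<N}. draw (\<sigma> i))"

definition actions :: "(nat \<Rightarrow> bool \<times> real) \<Rightarrow> nat \<Rightarrow> real option" where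
  "actions \<omega> i = (if fst (\<omega> i) then Some (snd (\<omega> i)) else None)"

text \<open>
  Payoffs are bounded above by \<open>V\<close> but not below, and a bid law may have infinite mean. The
  expected payoff is therefore taken in the extended reals, where it can be \<open>-\<infinity>\<close>; the Bochner
  integral would assign the value \<open>0\<close> to such strategies.
\<close>

definition expected_payoff ::
  "nat \<Rightarrow> real \<Rightarrow> real \<Rightarrow> real \<Rightarrow> real \<Rightarrow> (nat \<Rightarrow> strategy) \<Rightarrow> nat \<Rightarrow> ereal" where
  "expected_payoff N V g r1 r2 \<sigma> i =
     enn2ereal (\<integral>\<^sup>+ \<omega>. ennreal (payoff N V g r1 r2 (actions \<omega>) i) \<partial>draws N \<sigma>)
     - enn2ereal (\<integral>\<^sup>+ \<omega>. ennreal (- payoff N V g r1 r2 (actions \<omega>) i) \<partial>draws N \<sigma>)"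

definition nash_equilibrium ::
  "nat \<Rightarrow> real \<Rightarrow> real \<Rightarrow> real \<Rightarrow> real \<Rightarrow> (nat \<Rightarrow> strategy) \<Rightarrow> bool" where
  "nash_equilibrium N V g r1 r2 \<sigma> \<longleftrightarrow>
     (\<forall>i<N. mixed_strategy (\<sigma> i)) \<and>
     (\<forall>i<N. \<forall>s. mixed_strategy s \<longrightarrow>
        expected_payoff N V g r1 r2 (\<sigma>(i := s)) i \<le> expected_payoff N V g r1 r2 \<sigma> i)"

definition equilibrium_strategy ::
  "nat \<Rightarrow> real \<Rightarrow> real \<Rightarrow> real \<Rightarrow> real \<Rightarrow> strategy" where
  "equilibrium_strategy N V g r1 r2 = (THE s. nash_equilibrium N V g r1 r2 (\<lambda>_. s))"

definition equilibrium_draws ::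
  "nat \<Rightarrow> real \<Rightarrow> real \<Rightarrow> real \<Rightarrow> real \<Rightarrow> (nat \<Rightarrow> bool \<times> real) measure" where
  "equilibrium_draws N V g r1 r2 = draws N (\<lambda>_. equilibrium_strategy N V g r1 r2)"

definition expected_base_revenue ::
  "nat \<Rightarrow> real \<Rightarrow> real \<Rightarrow> real \<Rightarrow> real \<Rightarrow> real" where
  "expected_base_revenue N V g r1 r2 =
     (\<integral>\<omega>. base_revenue N g r1 (actions \<omega>) \<partial>equilibrium_draws N V g r1 r2)"

definition expected_priority_revenue ::
  "nat \<Rightarrow> real \<Rightarrow> real \<Rightarrow> real \<Rightarrow> real \<Rightarrow> real" where
  "expected_priority_revenue N V g r1 r2 =
     (\<integral>\<omega>. priority_revenue N r2 (actions \<omega>) \<partial>equilibrium_draws N V g r1 r2)"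

definition expected_revenue ::
  "nat \<Rightarrow> real \<Rightarrow> real \<Rightarrow> real \<Rightarrow> real \<Rightarrow> real" where
  "expected_revenue N V g r1 r2 =
     (\<integral>\<omega>. revenue N g r1 r2 (actions \<omega>) \<partial>equilibrium_draws N V g r1 r2)"

end

theory Submission
  imports Defs "HOL-Real_Asymp.Real_Asymp"
begin

text \<open>
  Against opponents who all play \<open>(p, F)\<close>, a bid \<open>b\<close> wins with probability
  \<open>W b = (p + (1 - p) * F b) ^ (N - 1)\<close> and is worth
  \<open>u b = W b * (V - g - b) - (1 - W b) * (r1 * g + r2 * b)\<close>. In a symmetric equilibrium with value
  \<open>U\<close> the continuous function \<open>u\<close> is at most \<open>U\<close> and equals \<open>U\<close> almost surely under \<open>F\<close>; abstaining
  is possible, so \<open>U \<ge> 0\<close> and \<open>p * U = 0\<close>. Comparing the bid \<open>0\<close> with the lowest bid in the support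
  shows that \<open>u 0 = U = 0\<close>, which determines \<open>p\<close>. The support has no gap: across a gap \<open>W\<close> is
  constant, while the level at which \<open>u\<close> vanishes strictly increases. Hence \<open>u = 0\<close> on
  \<open>[0, V - g]\<close>, which determines \<open>F\<close>.

  Since everybody earns \<open>0\<close> in equilibrium, the expected revenue is the expected surplus,
  \<open>V\<close> times the probability that somebody participates. The base revenue depends only on the number
  of participants, and the priority revenue is the difference.
\<close>

section \<open>The winner and the payoffs\<close>

lemma finite_participants [simp]: "finite (participants N a)"
  by (simp add: participants_def)

text \<open>Finitely many bids attain their maximum, so the \<open>LEAST\<close> in
  \<open>winner\<close> ranges over a nonempty set.\<close>

lemma winner_maximal:
  assumes "participants N a \<noteq> {}"
  shows "winner N a \<in> participants N a \<and> (\<forall>j\<in>participants N a. bid a j \<le> bid a (winner N a))"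
proof -
  have "Max (bid a ` participants N a) \<in> bid a ` participants N a"
    using assms by (intro Max_in) auto
  then obtain i where "i \<in> participants N a" "bid a i = Max (bid a ` participants N a)"
    by force
  then have "i \<in> participants N a \<and> (\<forall>j\<in>participants N a. bid a j \<le> bid a i)"
    by simp
  then show ?thesis
    unfolding winner_def by (rule LeastI)
qed

text \<open>Tie-breaking by index becomes a condition on one opponent at a time: smaller indices
  must bid strictly less, and an abstaining opponent is beaten vacuously. Winning is then a
  conjunction over independent draws.\<close>

definition beats :: "nat \<Rightarrow> nat \<Rightarrow> real \<Rightarrow> bool \<times> real \<Rightarrow> bool" where
  "beats i j b z \<longleftrightarrow> fst z \<longrightarrow> (if j < i then snd z < b else snd z \<le> b)"

lemma payoff_actions:
  assumes "i < N"
  shows "payoff N V g r1 r2 (actions \<omega>) i =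
    (if \<not> fst (\<omega> i) then 0
     else if \<forall>j\<in>{..<N} - {i}. beats i j (snd (\<omega> i)) (\<omega> j) then V - g - snd (\<omega> i)
     else - (r1 * g + r2 * snd (\<omega> i)))"
proof (cases "fst (\<omega> i)")
  case True
  let ?a = "actions \<omega>"
  have part: "j \<in> participants N ?a \<longleftrightarrow> j < N \<and> fst (\<omega> j)" for j
    by (auto simp: participants_def actions_def)
  have bid: "bid ?a j = snd (\<omega> j)" if "fst (\<omega> j)" for j
    using that by (simp add: bid_def actions_def)
  have "i = winner N ?a \<longleftrightarrow> (\<forall>j\<in>{..<N} - {i}. beats i j (snd (\<omega> i)) (\<omega> j))"
  proof
    assume i: "i = winner N ?a"
    have max: "bid ?a j \<le> bid ?a i" if "j \<in> participants N ?a" for j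
      using winner_maximal[of N ?a] that i by auto
    have "bid ?a j < bid ?a i" if j: "j \<in> participants N ?a" "j < i" for j
    proof -
      \<comment> \<open>By minimality of the winner's index, a smaller \<open>j\<close> is not a
        maximizer; whoever outbids \<open>j\<close> bids at most what \<open>i\<close> bids.\<close>
      have "\<not> (j \<in> participants N ?a \<and> (\<forall>k\<in>participants N ?a. bid ?a k \<le> bid ?a j))"
        using j(2) unfolding i winner_def by (rule not_less_Least)
      then obtain k where "k \<in> participants N ?a" "bid ?a j < bid ?a k"
        using j(1) by (meson not_le)
      then show ?thesis
        using max[of k] by linarith
    qed
    then show "\<forall>j\<in>{..<N} - {i}. beats i j (snd (\<omega> i)) (\<omega> j)"
      using max bid True by (auto simp: beats_def part)
  next
    assume *: "\<forall>j\<in>{..<N} - {i}. beats i j (snd (\<omega> i)) (\<omega> j)"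
    have le: "bid ?a j \<le> bid ?a i" if "j \<in> participants N ?a" for j
      using * bid True that by (cases "j = i") (auto simp: beats_def part split: if_splits)
    have "winner N ?a = i"
      unfolding winner_def
    proof (rule Least_equality)
      show "i \<in> participants N ?a \<and> (\<forall>j\<in>participants N ?a. bid ?a j \<le> bid ?a i)"
        using le True assms by (simp add: part)
    next
      fix j
      assume j: "j \<in> participants N ?a \<and> (\<forall>k\<in>participants N ?a. bid ?a k \<le> bid ?a j)"
      show "i \<le> j"
      proof (rule ccontr)
        assume "\<not> i \<le> j"
        then have "bid ?a j < bid ?a i"
          using * bid True j by (auto simp: beats_def part)
        moreover have "bid ?a i \<le> bid ?a j"
          using j True assms by (auto simp: part)
        ultimately show False by simp
      qed
    qed
    then show "i = winner N ?a" by simp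
  qed
  then show ?thesis
    using True assms bid by (simp add: payoff_def part)
qed (simp add: payoff_def participants_def actions_def)

text \<open>Accounting identity: every payment of an agent is revenue, and exactly one agent
  receives \<open>V\<close> when anybody participates.\<close>

lemma sum_payoff_eq:
  "(\<Sum>i<N. payoff N V g r1 r2 a i) = (if participants N a = {} then 0 else V) - revenue N g r1 r2 a"
proof (cases "participants N a = {}")
  case True
  then show ?thesis
    by (simp add: payoff_def revenue_def base_revenue_def priority_revenue_def)
next
  case False
  let ?P = "participants N a" and ?w = "winner N a"
  have w: "?w \<in> ?P"
    using winner_maximal[OF False] by simp
  have "(\<Sum>i<N. payoff N V g r1 r2 a i) = (\<Sum>i\<in>?P. payoff N V g r1 r2 a i)"
    by (rule sum.mono_neutral_right) (auto simp: payoff_def participants_def)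
  also have "\<dots> = payoff N V g r1 r2 a ?w + (\<Sum>i\<in>losers N a. payoff N V g r1 r2 a i)"
    unfolding losers_def by (rule sum.remove[OF _ w]) simp
  also have "(\<Sum>i\<in>losers N a. payoff N V g r1 r2 a i) = (\<Sum>i\<in>losers N a. - (r1 * g + r2 * bid a i))"
    by (rule sum.cong) (auto simp: payoff_def losers_def)
  finally show ?thesis
    using w False
    by (simp add: payoff_def revenue_def base_revenue_def priority_revenue_def
        sum.distrib sum_negf sum_distrib_left sum_subtractf)
qed

section \<open>Strategies as probability measures\<close>

lemma mixed_strategyD:
  assumes "mixed_strategy (p, F)"
  shows "0 \<le> p" "p \<le> 1" "mono F" "continuous_on UNIV F" "\<And>b. b \<le> 0 \<Longrightarrow> F b = 0"
    "(F \<longlongrightarrow> 1) at_top" "(F \<longlongrightarrow> 0) at_bot" "\<And>x. isCont F x" "\<And>x. continuous (at_right x) F"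
proof -
  show "0 \<le> p" "p \<le> 1" "mono F" "continuous_on UNIV F" "\<And>b. b \<le> 0 \<Longrightarrow> F b = 0" "(F \<longlongrightarrow> 1) at_top"
    using assms by (auto simp: mixed_strategy_def)
  show "(F \<longlongrightarrow> 0) at_bot"
  proof (rule tendsto_eventually)
    show "\<forall>\<^sub>F x in at_bot. F x = 0"
      using assms by (auto simp: mixed_strategy_def eventually_at_bot_linorder)
  qed
  show "isCont F x" for x
    using assms by (auto simp: mixed_strategy_def continuous_on_eq_continuous_at)
  then show "continuous (at_right x) F" for x
    by (metis continuous_at_imp_continuous_at_within)
qed

lemma mixed_strategy_cdf_bounds:
  assumes "mixed_strategy (p, F)"
  shows "0 \<le> F x" "F x \<le> 1"
proof -
  note F = mixed_strategyD[OF assms]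
  show "0 \<le> F x"
  proof (cases "x \<le> 0")
    case False
    then have "F 0 \<le> F x"
      by (intro monoD[OF F(3)]) simp
    then show ?thesis using F(5)[of 0] by simp
  qed (simp add: F(5))
  show "F x \<le> 1"
  proof (rule tendsto_lowerbound[OF F(6)])
    show "\<forall>\<^sub>F y in at_top. F x \<le> F y"
      unfolding eventually_at_top_linorder using monoD[OF F(3), of x] by blast
  qed simp
qed

lemma real_distribution_mixed_strategy:
  assumes "mixed_strategy (p, F)"
  shows "real_distribution (interval_measure F)"
  using mixed_strategyD[OF assms] by (intro real_distribution_interval_measure) (auto dest: monoD)

text \<open>Continuity of \<open>F\<close> makes every singleton null, so open and closed half-lines
  have the same mass; \<open>F 0 = 0\<close> puts all mass on positive bids.\<close>

lemma
  assumes "mixed_strategy (p, F)"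
  shows emeasure_bid_le: "emeasure (interval_measure F) {..b} = ennreal (F b)"
    and emeasure_bid_less: "emeasure (interval_measure F) {..<b} = ennreal (F b)"
    and AE_bid_pos: "AE b in interval_measure F. 0 < b"
proof -
  note F = mixed_strategyD[OF assms]
  interpret real_distribution "interval_measure F"
    by (rule real_distribution_mixed_strategy[OF assms])
  have cdf: "cdf (interval_measure F) = F"
    using F by (intro cdf_interval_measure) (auto dest: monoD)
  have le: "measure (interval_measure F) {..b} = F b" for b
    using cdf by (metis cdf_def)
  then show *: "emeasure (interval_measure F) {..b} = ennreal (F b)" for b
    by (simp add: emeasure_eq_measure)
  have "measure (interval_measure F) {b} = 0"
    using isCont_cdf[of b] F(8) by (simp add: cdf)
  moreover have "measure (interval_measure F) {..b} = measure (interval_measure F) ({..<b} \<union> {b})"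
    by (rule arg_cong[where f = "measure _"]) auto
  then have "measure (interval_measure F) {..b} = measure (interval_measure F) {..<b} + measure (interval_measure F) {b}"
    by (subst (asm) finite_measure_Union) auto
  ultimately show "emeasure (interval_measure F) {..<b} = ennreal (F b)"
    using le by (simp add: emeasure_eq_measure)
  have "emeasure (interval_measure F) {..0} = 0"
    using *[of 0] F(5)[of 0] by simp
  then show "AE b in interval_measure F. 0 < b"
    by (intro AE_I[of _ _ "{..0}"]) auto
qed

text \<open>The sigma-algebra is the same for all strategies, so measurability can be checked in one
  fixed product space.\<close>

lemma sets_draw [simp, measurable_cong]: "sets (draw s) = sets (count_space UNIV \<Otimes>\<^sub>M borel)"
  by (auto simp: draw_def split: prod.split intro!: sets_pair_measure_cong)

lemma space_draw [simp]: "space (draw s) = UNIV"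
  using sets_eq_imp_space_eq[OF sets_draw[of s]] by (simp add: space_pair_measure)

lemma prob_space_draw:
  assumes "mixed_strategy s"
  shows "prob_space (draw s)"
proof -
  obtain p F where s: "s = (p, F)" by fastforce
  interpret real_distribution "interval_measure F"
    using assms real_distribution_mixed_strategy s by blast
  show ?thesis
    unfolding s draw_def by (simp add: prob_space_pair prob_space_measure_pmf prob_space_axioms)
qed

text \<open>Fubini for a two-valued first coordinate.\<close>

lemma nn_integral_draw:
  assumes "mixed_strategy (p, F)" and [measurable]: "h \<in> borel_measurable (count_space UNIV \<Otimes>\<^sub>M borel)"
  shows "(\<integral>\<^sup>+ z. h z \<partial>draw (p, F)) =
    ennreal p * (\<integral>\<^sup>+ b. h (False, b) \<partial>interval_measure F)
    + ennreal (1 - p) * (\<integral>\<^sup>+ b. h (True, b) \<partial>interval_measure F)"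
proof -
  interpret real_distribution "interval_measure F"
    by (rule real_distribution_mixed_strategy[OF assms(1)])
  have "h \<in> borel_measurable (measure_pmf (bernoulli_pmf (1 - p)) \<Otimes>\<^sub>M interval_measure F)"
    by measurable
  from nn_integral_fst[OF this] show ?thesis
    using mixed_strategyD(1,2)[OF assms(1)] by (simp add: draw_def mult.commute add.commute)
qed

text \<open>The opponent abstains, or participates with a lower bid. Without atoms the tie rule has
  no effect, so the result is free of \<open>i\<close> and \<open>j\<close>.\<close>

lemma emeasure_draw_beats:
  assumes "mixed_strategy (p, F)"
  shows "emeasure (draw (p, F)) {z. beats i j b z} = ennreal (p + (1 - p) * F b)"
proof -
  interpret real_distribution "interval_measure F"
    by (rule real_distribution_mixed_strategy[OF assms(1)])
  note F = mixed_strategyD[OF assms] mixed_strategy_cdf_bounds[OF assms]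
  have "{z \<in> space (count_space UNIV \<Otimes>\<^sub>M borel). beats i j b z} \<in> sets (count_space UNIV \<Otimes>\<^sub>M borel)"
    unfolding beats_def by measurable
  then have m: "{z. beats i j b z} \<in> sets (count_space UNIV \<Otimes>\<^sub>M borel)"
    by (simp add: space_pair_measure)
  have "emeasure (draw (p, F)) {z. beats i j b z} = (\<integral>\<^sup>+ z. indicator {z. beats i j b z} z \<partial>draw (p, F))"
    using m by simp
  also have "\<dots> = ennreal p * (\<integral>\<^sup>+ x. indicator {z. beats i j b z} (False, x) \<partial>interval_measure F)
      + ennreal (1 - p) * (\<integral>\<^sup>+ x. indicator {z. beats i j b z} (True, x) \<partial>interval_measure F)"
    using m by (intro nn_integral_draw[OF assms] borel_measurable_indicator)
  also have "(\<lambda>x. indicator {z. beats i j b z} (False, x)) = (\<lambda>x::real. indicator UNIV x :: ennreal)"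
    by (auto simp: beats_def indicator_def)
  also have "(\<lambda>x. indicator {z. beats i j b z} (True, x)) =
      (\<lambda>x. indicator (if j < i then {..<b} else {..b}) x :: ennreal)"
    by (auto simp: beats_def indicator_def)
  also have "(\<integral>\<^sup>+ x. indicator (if j < i then {..<b} else {..b}) x \<partial>interval_measure F) = ennreal (F b)"
    by (cases "j < i") (simp_all add: emeasure_bid_le[OF assms] emeasure_bid_less[OF assms])
  also have "(\<integral>\<^sup>+ x. indicator UNIV x \<partial>interval_measure F) = 1"
    using emeasure_space_1 by simp
  also have "ennreal p * 1 + ennreal (1 - p) * ennreal (F b) = ennreal (p + (1 - p) * F b)"
    using F by (simp add: ennreal_mult ennreal_plus)
  finally show ?thesis .
qed

lemma sets_draws [measurable_cong]:
  "sets (draws N \<sigma>) = sets (\<Pi>\<^sub>M i\<in>{..<N}. (count_space UNIV \<Otimes>\<^sub>M borel :: (bool \<times> real) measure))"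
  unfolding draws_def by (intro sets_PiM_cong) simp_all

lemma measurable_draws_component:
  assumes "i < N"
  shows "(\<lambda>\<omega>. snd (\<omega> i)) \<in> borel_measurable (draws N \<sigma>)"
    and "Measurable.pred (draws N \<sigma>) (\<lambda>\<omega>. fst (\<omega> i))"
proof -
  have [measurable]: "(\<lambda>\<omega>. \<omega> i) \<in> draws N \<sigma> \<rightarrow>\<^sub>M (count_space UNIV \<Otimes>\<^sub>M borel)"
    unfolding measurable_cong_sets[OF sets_draws refl]
    using assms by (intro measurable_component_singleton) simp
  show "(\<lambda>\<omega>. snd (\<omega> i)) \<in> borel_measurable (draws N \<sigma>)"
    and "Measurable.pred (draws N \<sigma>) (\<lambda>\<omega>. fst (\<omega> i))"
    by measurable
qed

lemma measurable_payoff: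
  assumes i: "i < N"
  shows "(\<lambda>\<omega>. payoff N V g r1 r2 (actions \<omega>) i) \<in> borel_measurable (draws N \<sigma>)"
proof -
  note [measurable] = measurable_draws_component[OF i]
  have "Measurable.pred (draws N \<sigma>) (\<lambda>\<omega>. beats i j (snd (\<omega> i)) (\<omega> j))" if "j < N" for j
  proof -
    show ?thesis
      \<comment> \<open>Non-strict comparisons become negated strict ones, which are covered by
        \<open>borel_measurable_pred_less\<close>.\<close>
      unfolding beats_def not_less[symmetric, of "snd _"]
      by (cases "j < i"; simp only: if_True if_False;
          intro pred_intros_logic borel_measurable_pred_less
            measurable_draws_component i that)
  qed
  then have [measurable]: "Measurable.pred (draws N \<sigma>)
      (\<lambda>\<omega>. \<forall>j\<in>{..<N} - {i}. beats i j (snd (\<omega> i)) (\<omega> j))"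
    by (intro pred_intros_finite) auto
  show ?thesis
    unfolding payoff_actions[OF i] by measurable
qed

section \<open>Integrals of the payoff after a unilateral deviation\<close>

definition win_prob :: "nat \<Rightarrow> strategy \<Rightarrow> real \<Rightarrow> real" where
  "win_prob N s b = (fst s + (1 - fst s) * snd s b) ^ (N - 1)"

lemma accept_prob_bounds:
  assumes "mixed_strategy (p, F)"
  shows "0 \<le> p + (1 - p) * F b" "p + (1 - p) * F b \<le> 1"
proof -
  note F = mixed_strategyD(1,2)[OF assms] mixed_strategy_cdf_bounds[OF assms, of b]
  show "0 \<le> p + (1 - p) * F b"
    using F by simp
  have "(1 - p) * F b \<le> (1 - p) * 1"
    using F by (intro mult_left_mono) auto
  then show "p + (1 - p) * F b \<le> 1" by simp
qed

lemma win_prob_bounds: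
  assumes "mixed_strategy s"
  shows "0 \<le> win_prob N s b" "win_prob N s b \<le> 1"
  using accept_prob_bounds[of "fst s" "snd s"] assms
  by (auto simp: win_prob_def intro: power_le_one)

lemma continuous_win_prob:
  assumes "mixed_strategy s"
  shows "continuous_on UNIV (win_prob N s)"
proof -
  have "continuous_on UNIV (snd s)"
    using assms mixed_strategyD(4)[of "fst s" "snd s"] by simp
  then show ?thesis
    unfolding win_prob_def by (intro continuous_intros)
qed

text \<open>Given the deviator's bid, the payoff takes two values, and winning is a product event of
  the opponents' independent draws. The test function \<open>\<psi>\<close> lets one computation
  serve both the positive and the negative part of the payoff; \<open>\<psi> 0 = 0\<close> removes
  the abstaining branch.\<close>

lemma nn_integral_payoff_deviation:
  fixes \<psi> :: "real \<Rightarrow> ennreal"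
  assumes s: "mixed_strategy s" and s': "mixed_strategy (p', F')" and i: "i < N"
    and [measurable]: "\<psi> \<in> borel_measurable borel" and \<psi>0: "\<psi> 0 = 0"
  shows "(\<integral>\<^sup>+ \<omega>. \<psi> (payoff N V g r1 r2 (actions \<omega>) i) \<partial>draws N ((\<lambda>_. s)(i := (p', F')))) =
    ennreal (1 - p') * (\<integral>\<^sup>+ b. ennreal (win_prob N s b) * \<psi> (V - g - b)
      + ennreal (1 - win_prob N s b) * \<psi> (- (r1 * g + r2 * b)) \<partial>interval_measure F')"
    (is "integral\<^sup>N ?D ?f = _ * (\<integral>\<^sup>+ b. ?u b \<partial>_)")
proof -
  define I where "I = {..<N} - {i}"
  define \<sigma> where "\<sigma> = (\<lambda>_::nat. s)(i := (p', F'))"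
  have I: "insert i I = {..<N}" "finite I" "i \<notin> I" "card I = N - 1"
    using i by (auto simp: I_def)
  have \<sigma>: "mixed_strategy (\<sigma> j)" for j
    using s s' by (simp add: \<sigma>_def)
  interpret product_sigma_finite "\<lambda>j. draw (\<sigma> j)"
    by (simp add: product_sigma_finite_def prob_space_imp_sigma_finite prob_space_draw \<sigma>)
  interpret P: prob_space "Pi\<^sub>M I (\<lambda>j. draw (\<sigma> j))"
    by (intro prob_space_PiM prob_space_draw \<sigma>)
  have D: "?D = Pi\<^sub>M (insert i I) (\<lambda>j. draw (\<sigma> j))"
    unfolding draws_def I \<sigma>_def by simp
  have [measurable]: "win_prob N s \<in> borel_measurable borel"
    by (intro borel_measurable_continuous_onI continuous_win_prob s)
  \<comment> \<open>With the deviator's draw \<open>y\<close> fixed, the integral runs over the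
    opponents only; \<open>S\<close> below is the box on which all of them are beaten.\<close>
  have inner: "(\<integral>\<^sup>+ x. ?f (x(i := y)) \<partial>Pi\<^sub>M I (\<lambda>j. draw (\<sigma> j))) = (if fst y then ?u (snd y) else 0)" for y
  proof (cases "fst y")
    case True
    define c where "c = \<psi> (V - g - snd y)"
    define d where "d = \<psi> (- (r1 * g + r2 * snd y))"
    define S where "S = (\<Pi>\<^sub>E j\<in>I. {z. beats i j (snd y) z})"
    have "{z \<in> space (count_space UNIV \<Otimes>\<^sub>M borel). beats i j b z} \<in> sets (count_space UNIV \<Otimes>\<^sub>M borel)" for j b
      unfolding beats_def by measurable
    then have beats: "{z. beats i j b z} \<in> sets (draw t)" for j b t
      by (simp add: space_pair_measure)
    have S: "S \<in> sets (Pi\<^sub>M I (\<lambda>j. draw (\<sigma> j)))"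
      unfolding S_def by (intro sets_PiM_I_finite I beats)
    have "emeasure (Pi\<^sub>M I (\<lambda>j. draw (\<sigma> j))) S = (\<Prod>j\<in>I. emeasure (draw (\<sigma> j)) {z. beats i j (snd y) z})"
      unfolding S_def by (intro emeasure_PiM I beats)
    also have "\<dots> = (\<Prod>j\<in>I. ennreal (fst s + (1 - fst s) * snd s (snd y)))"
    proof (rule prod.cong)
      fix j assume "j \<in> I"
      then have "\<sigma> j = (fst s, snd s)"
        using I by (auto simp: \<sigma>_def)
      then show "emeasure (draw (\<sigma> j)) {z. beats i j (snd y) z} = ennreal (fst s + (1 - fst s) * snd s (snd y))"
        using emeasure_draw_beats[of "fst s" "snd s"] s by simp
    qed simp
    also have "\<dots> = ennreal (win_prob N s (snd y))"
      using accept_prob_bounds[of "fst s" "snd s"] s I by (simp add: win_prob_def ennreal_power)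
    finally have emS: "emeasure (Pi\<^sub>M I (\<lambda>j. draw (\<sigma> j))) S = ennreal (win_prob N s (snd y))" .
    then have emC: "emeasure (Pi\<^sub>M I (\<lambda>j. draw (\<sigma> j))) (space (Pi\<^sub>M I (\<lambda>j. draw (\<sigma> j))) - S)
        = ennreal (1 - win_prob N s (snd y))"
      using S win_prob_bounds[OF s] by (simp add: emeasure_compl P.emeasure_space_1 ennreal_minus flip: ennreal_1)
    have "?f (x(i := y)) = c * indicator S x + d * indicator (space (Pi\<^sub>M I (\<lambda>j. draw (\<sigma> j))) - S) x"
      if x: "x \<in> space (Pi\<^sub>M I (\<lambda>j. draw (\<sigma> j)))" for x
    proof -
      have "(\<forall>j\<in>{..<N} - {i}. beats i j (snd ((x(i := y)) i)) ((x(i := y)) j)) \<longleftrightarrow> x \<in> S"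
        using x by (auto simp: S_def space_PiM PiE_iff I_def)
      then show ?thesis
        using x True unfolding payoff_actions[OF i] by (simp add: c_def d_def)
    qed
    then have "(\<integral>\<^sup>+ x. ?f (x(i := y)) \<partial>Pi\<^sub>M I (\<lambda>j. draw (\<sigma> j)))
        = (\<integral>\<^sup>+ x. c * indicator S x + d * indicator (space (Pi\<^sub>M I (\<lambda>j. draw (\<sigma> j))) - S) x \<partial>Pi\<^sub>M I (\<lambda>j. draw (\<sigma> j)))"
      by (intro nn_integral_cong)
    also have "\<dots> = c * ennreal (win_prob N s (snd y)) + d * ennreal (1 - win_prob N s (snd y))"
      using S by (subst nn_integral_add) (simp_all add: nn_integral_cmult_indicator emS emC)
    finally show ?thesis
      using True by (simp add: c_def d_def mult.commute)
  qed (simp add: payoff_actions[OF i] \<psi>0)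
  \<comment> \<open>Fubini with the opponents inside and the deviator outside.\<close>
  have "integral\<^sup>N ?D ?f = (\<integral>\<^sup>+ y. \<integral>\<^sup>+ x. ?f (x(i := y)) \<partial>Pi\<^sub>M I (\<lambda>j. draw (\<sigma> j)) \<partial>draw (\<sigma> i))"
    unfolding D
  proof (rule product_nn_integral_insert_rev[OF I(2,3)])
    have "?f \<in> borel_measurable ?D"
      using measurable_payoff[OF i] by measurable
    then show "?f \<in> borel_measurable (Pi\<^sub>M (insert i I) (\<lambda>j. draw (\<sigma> j)))"
      unfolding D .
  qed
  also have "\<dots> = (\<integral>\<^sup>+ y. (if fst y then ?u (snd y) else 0) \<partial>draw (p', F'))"
    unfolding inner by (simp add: \<sigma>_def)
  also have "\<dots> = ennreal (1 - p') * (\<integral>\<^sup>+ b. ?u b \<partial>interval_measure F')"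
    by (subst nn_integral_draw[OF s']) simp_all
  finally show ?thesis .
qed

section \<open>Expected payoffs of deviations\<close>

definition bid_value :: "nat \<Rightarrow> real \<Rightarrow> real \<Rightarrow> real \<Rightarrow> real \<Rightarrow> strategy \<Rightarrow> real \<Rightarrow> real" where
  "bid_value N V g r1 r2 s b =
     win_prob N s b * (V - g - b) - (1 - win_prob N s b) * (r1 * g + r2 * b)"

text \<open>
  The gain and the loss part are kept apart because the expected payoff is a difference of two
  nonnegative integrals of which the second may be infinite.
\<close>

definition bid_gain :: "nat \<Rightarrow> real \<Rightarrow> real \<Rightarrow> strategy \<Rightarrow> real \<Rightarrow> real" where
  "bid_gain N V g s b = win_prob N s b * max 0 (V - g - b)"

definition bid_loss :: "nat \<Rightarrow> real \<Rightarrow> real \<Rightarrow> real \<Rightarrow> real \<Rightarrow> strategy \<Rightarrow> real \<Rightarrow> real" where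
  "bid_loss N V g r1 r2 s b =
     win_prob N s b * max 0 (- (V - g - b)) + (1 - win_prob N s b) * (r1 * g + r2 * b)"

lemma bid_value_eq: "bid_value N V g r1 r2 s b = bid_gain N V g s b - bid_loss N V g r1 r2 s b"
  by (auto simp: bid_value_def bid_gain_def bid_loss_def max_def algebra_simps)

lemma continuous_bid_value:
  assumes "mixed_strategy s"
  shows "continuous_on A (bid_value N V g r1 r2 s)"
proof (rule continuous_on_subset)
  show "continuous_on UNIV (bid_value N V g r1 r2 s)"
    unfolding bid_value_def using continuous_win_prob[OF assms] by (intro continuous_intros)
qed simp

text \<open>The parameters are locale variables because the comparative statics and limits at the
  end instantiate the results at other values of \<open>N\<close>, \<open>r1\<close> and
  \<open>r2\<close>.\<close>

locale auction =
  fixes N :: nat and V g r1 r2 :: real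
  assumes N: "2 \<le> N" and g: "0 < g" and V: "g < V"
    and r1: "0 \<le> r1" "r1 \<le> 1" and r2: "0 \<le> r2" "r2 \<le> 1" and r12: "r1 \<noteq> 0 \<or> r2 \<noteq> 0"
begin

abbreviation "u \<equiv> bid_value N V g r1 r2"
abbreviation "gain \<equiv> bid_gain N V g"
abbreviation "loss \<equiv> bid_loss N V g r1 r2"
abbreviation "W \<equiv> win_prob N"

lemma penalty_nonneg: "0 \<le> b \<Longrightarrow> 0 \<le> r1 * g + r2 * b"
  using g r1 r2 by simp

text \<open>Here the assumption that one rate is nonzero enters: losing with a positive bid is
  costly.\<close>

lemma penalty_pos: "0 < b \<Longrightarrow> 0 < r1 * g + r2 * b"
  using g r1 r2 r12 by (cases "r1 = 0") (auto intro: add_pos_nonneg)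

lemma gain_nonneg: "mixed_strategy s \<Longrightarrow> 0 \<le> gain s b"
  using win_prob_bounds[of s] by (simp add: bid_gain_def)

lemma loss_nonneg: "mixed_strategy s \<Longrightarrow> 0 \<le> b \<Longrightarrow> 0 \<le> loss s b"
  using win_prob_bounds[of s] penalty_nonneg[of b] by (simp add: bid_loss_def)

lemma gain_le:
  assumes "mixed_strategy s" "0 \<le> b"
  shows "gain s b \<le> V - g"
proof -
  have "gain s b \<le> 1 * (V - g)"
    unfolding bid_gain_def using win_prob_bounds[OF assms(1)] assms(2) V by (intro mult_mono) auto
  then show ?thesis by simp
qed

lemma measurable_gain_loss:
  assumes "mixed_strategy s"
  shows "gain s \<in> borel_measurable borel" "loss s \<in> borel_measurable borel" "u s \<in> borel_measurable borel"
proof -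
  have [measurable]: "W s \<in> borel_measurable borel"
    by (intro borel_measurable_continuous_onI continuous_win_prob assms)
  show "gain s \<in> borel_measurable borel" "loss s \<in> borel_measurable borel" "u s \<in> borel_measurable borel"
    unfolding bid_gain_def bid_loss_def bid_value_def by measurable
qed

text \<open>The test functions are \<open>ennreal\<close> and \<open>ennreal\<close> of the
  negative. Truncation at \<open>0\<close> removes the penalty from the gain and keeps it in the
  loss, since bids are almost surely positive.\<close>

lemma nn_integral_payoff_deviation_parts:
  assumes s: "mixed_strategy s" and s': "mixed_strategy (p', F')" and i: "i < N"
  shows "(\<integral>\<^sup>+ \<omega>. ennreal (payoff N V g r1 r2 (actions \<omega>) i) \<partial>draws N ((\<lambda>_. s)(i := (p', F'))))
      = ennreal (1 - p') * (\<integral>\<^sup>+ b. ennreal (gain s b) \<partial>interval_measure F')" (is ?gain)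
    and "(\<integral>\<^sup>+ \<omega>. ennreal (- payoff N V g r1 r2 (actions \<omega>) i) \<partial>draws N ((\<lambda>_. s)(i := (p', F'))))
      = ennreal (1 - p') * (\<integral>\<^sup>+ b. ennreal (loss s b) \<partial>interval_measure F')" (is ?loss)
proof -
  note W = win_prob_bounds[OF s]
  show ?gain
    unfolding nn_integral_payoff_deviation[OF s s' i measurable_ennreal ennreal_0]
  proof (intro arg_cong2[where f = "(*)"] nn_integral_cong_AE refl)
    show "AE b in interval_measure F'. ennreal (W s b) * ennreal (V - g - b)
        + ennreal (1 - W s b) * ennreal (- (r1 * g + r2 * b)) = ennreal (gain s b)"
      using AE_bid_pos[OF s']
    proof eventually_elim
      case (elim b)
      then have "ennreal (- (r1 * g + r2 * b)) = 0"
        using penalty_nonneg[of b] by (intro ennreal_neg) simp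
      moreover have "ennreal (V - g - b) = ennreal (max 0 (V - g - b))"
        by (simp add: max_def ennreal_neg)
      ultimately show ?case
        using W by (simp add: bid_gain_def ennreal_mult)
    qed
  qed
  show ?loss
    using W
  proof (subst nn_integral_payoff_deviation[OF s s' i, of "\<lambda>x. ennreal (- x)"])
    show "ennreal (1 - p') * (\<integral>\<^sup>+ b. ennreal (W s b) * ennreal (- (V - g - b))
        + ennreal (1 - W s b) * ennreal (- (- (r1 * g + r2 * b))) \<partial>interval_measure F')
      = ennreal (1 - p') * (\<integral>\<^sup>+ b. ennreal (loss s b) \<partial>interval_measure F')"
    proof (intro arg_cong2[where f = "(*)"] nn_integral_cong_AE refl)
      show "AE b in interval_measure F'. ennreal (W s b) * ennreal (- (V - g - b))
          + ennreal (1 - W s b) * ennreal (- (- (r1 * g + r2 * b))) = ennreal (loss s b)"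
        using AE_bid_pos[OF s']
      proof eventually_elim
        case (elim b)
        have "ennreal (- (V - g - b)) = ennreal (max 0 (- (V - g - b)))"
          by (simp add: max_def ennreal_neg)
        then show ?case
          using W penalty_nonneg[of b] elim
            by (simp add: bid_loss_def ennreal_mult ennreal_plus add.commute[of "r2 * b"])
      qed
    qed
  qed simp_all
qed

text \<open>The gain is at most \<open>V - g\<close>. Hence the expected payoff is never a
  difference of two infinities.\<close>

lemma nn_integral_gain_finite:
  assumes s: "mixed_strategy s" and s': "mixed_strategy (p', F')"
  shows "(\<integral>\<^sup>+ b. ennreal (gain s b) \<partial>interval_measure F') < \<infinity>"
proof -
  interpret real_distribution "interval_measure F'"
    by (rule real_distribution_mixed_strategy[OF s'])
  have "(\<integral>\<^sup>+ b. ennreal (gain s b) \<partial>interval_measure F') \<le> (\<integral>\<^sup>+ b. ennreal (V - g) \<partial>interval_measure F')"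
  proof (rule nn_integral_mono_AE)
    show "AE b in interval_measure F'. ennreal (gain s b) \<le> ennreal (V - g)"
      using AE_bid_pos[OF s'] by eventually_elim (intro ennreal_leI gain_le s, simp)
  qed
  also have "\<dots> < \<infinity>"
    using emeasure_space_1 by simp
  finally show ?thesis .
qed

lemma expected_payoff_deviation_le_0:
  assumes s: "mixed_strategy s" and s': "mixed_strategy (p', F')" and i: "i < N"
    and u: "\<And>b. 0 \<le> b \<Longrightarrow> u s b \<le> 0"
  shows "expected_payoff N V g r1 r2 ((\<lambda>_. s)(i := (p', F'))) i \<le> 0"
proof -
  define A where "A = ennreal (1 - p') * (\<integral>\<^sup>+ b. ennreal (gain s b) \<partial>interval_measure F')"
  define B where "B = ennreal (1 - p') * (\<integral>\<^sup>+ b. ennreal (loss s b) \<partial>interval_measure F')"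
  have "(\<integral>\<^sup>+ b. ennreal (gain s b) \<partial>interval_measure F') \<le> (\<integral>\<^sup>+ b. ennreal (loss s b) \<partial>interval_measure F')"
  proof (rule nn_integral_mono_AE)
    show "AE b in interval_measure F'. ennreal (gain s b) \<le> ennreal (loss s b)"
      using AE_bid_pos[OF s']
    proof eventually_elim
      case (elim b)
      then show ?case
        using u[of b] by (intro ennreal_leI) (simp add: bid_value_eq)
    qed
  qed
  then have "A \<le> B"
    unfolding A_def B_def by (rule mult_left_mono) simp
  then have "enn2ereal A - enn2ereal B \<le> 0"
    using nn_integral_gain_finite[OF s s']
    by (intro ereal_diff_nonpos) (auto simp: A_def less_eq_ennreal.rep_eq ennreal_mult_eq_top_iff)
  then show ?thesis
    unfolding expected_payoff_def nn_integral_payoff_deviation_parts[OF s s' i] A_def B_def .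
qed

text \<open>A finite expected loss makes both parts integrable, and the extended-real difference
  turns into an ordinary integral of \<open>u s\<close>.\<close>

lemma expected_payoff_deviation_eq:
  assumes s: "mixed_strategy s" and s': "mixed_strategy (p', F')" and i: "i < N"
    and fin: "(\<integral>\<^sup>+ b. ennreal (loss s b) \<partial>interval_measure F') < \<infinity>"
  shows "integrable (interval_measure F') (u s)"
    and "expected_payoff N V g r1 r2 ((\<lambda>_. s)(i := (p', F'))) i
      = ereal ((1 - p') * (\<integral>b. u s b \<partial>interval_measure F'))"
proof -
  note [measurable] = measurable_gain_loss[OF s]
  have pos: "AE b in interval_measure F'. 0 \<le> gain s b" "AE b in interval_measure F'. 0 \<le> loss s b"
    using AE_bid_pos[OF s'] by (eventually_elim; simp add: gain_nonneg loss_nonneg s)+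
  have int: "integrable (interval_measure F') (gain s)" "integrable (interval_measure F') (loss s)"
    using nn_integral_gain_finite[OF s s'] fin by (auto intro!: integrableI_nonneg pos)
  then show "integrable (interval_measure F') (u s)"
    unfolding bid_value_eq by (rule Bochner_Integration.integrable_diff)
  have "(\<integral>b. u s b \<partial>interval_measure F') = (\<integral>b. gain s b \<partial>interval_measure F') - (\<integral>b. loss s b \<partial>interval_measure F')"
    unfolding bid_value_eq using int by (rule Bochner_Integration.integral_diff)
  moreover have "(\<integral>\<^sup>+ b. ennreal (gain s b) \<partial>interval_measure F') = ennreal (\<integral>b. gain s b \<partial>interval_measure F')"
      "(\<integral>\<^sup>+ b. ennreal (loss s b) \<partial>interval_measure F') = ennreal (\<integral>b. loss s b \<partial>interval_measure F')"
    using int pos by (auto intro!: nn_integral_eq_integral)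
  moreover have "0 \<le> (\<integral>b. gain s b \<partial>interval_measure F')" "0 \<le> (\<integral>b. loss s b \<partial>interval_measure F')"
    using pos by (auto intro: integral_nonneg_AE)
  ultimately show "expected_payoff N V g r1 r2 ((\<lambda>_. s)(i := (p', F'))) i
      = ereal ((1 - p') * (\<integral>b. u s b \<partial>interval_measure F'))"
    unfolding expected_payoff_def nn_integral_payoff_deviation_parts[OF s s' i]
    using mixed_strategyD(1,2)[OF s']
    by (simp add: enn2ereal_ennreal right_diff_distrib flip: ennreal_mult)
qed

end

section \<open>Necessary conditions for an equilibrium\<close>

text \<open>The uniform law on \<open>[x, x + e]\<close>. A pure bid has an atom and so is no
  admissible strategy; a uniform bid on a short interval stands in for it.\<close>

definition uniform_cdf :: "real \<Rightarrow> real \<Rightarrow> real \<Rightarrow> real" where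
  "uniform_cdf x e t = max 0 (min 1 ((t - x) / e))"

lemma mixed_strategy_uniform:
  assumes "0 \<le> x" "0 < e"
  shows "mixed_strategy (0, uniform_cdf x e)"
proof -
  have "mono (uniform_cdf x e)"
    unfolding uniform_cdf_def using assms by (intro monoI max.mono min.mono divide_right_mono) auto
  moreover have "continuous_on UNIV (uniform_cdf x e)"
    unfolding uniform_cdf_def using assms by (intro continuous_intros) auto
  moreover have "uniform_cdf x e b = 0" if "b \<le> 0" for b
  proof -
    have "(b - x) / e \<le> 0"
      using assms that by (intro divide_nonpos_pos) auto
    then show ?thesis
      by (simp add: uniform_cdf_def)
  qed
  moreover have "(uniform_cdf x e \<longlongrightarrow> 1) at_top"
  proof (rule tendsto_eventually)
    show "\<forall>\<^sub>F t in at_top. uniform_cdf x e t = 1"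
      using assms by (auto simp: uniform_cdf_def eventually_at_top_linorder field_simps intro!: exI[of _ "x + e"])
  qed
  ultimately show ?thesis
    by (simp add: mixed_strategy_def)
qed

lemma AE_bid_le:
  assumes "mixed_strategy (p, F)" "F b = 1"
  shows "AE x in interval_measure F. x \<le> b"
proof -
  interpret real_distribution "interval_measure F"
    by (rule real_distribution_mixed_strategy[OF assms(1)])
  have "prob {..b} = 1"
    using emeasure_bid_le[OF assms(1), of b] assms(2) by (simp add: emeasure_eq_measure)
  then show ?thesis
    using prob_eq_1[of "{..b}"] by simp
qed

lemma AE_bid_ge:
  assumes "mixed_strategy (p, F)" "F b = 0"
  shows "AE x in interval_measure F. b < x"
proof -
  have "emeasure (interval_measure F) {..b} = 0"
    using emeasure_bid_le[OF assms(1), of b] assms(2) by simp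
  then show ?thesis
    by (intro AE_I[of _ _ "{..b}"]) auto
qed

text \<open>The witness is the least point at or above \<open>b\<close> where \<open>v\<close>
  equals \<open>U\<close>; it exists because \<open>v\<close> is continuous. Between
  \<open>b\<close> and that point \<open>v\<close> differs from \<open>U\<close>, so this interval
  has no mass and \<open>F\<close> stays constant across it.\<close>

lemma first_bid_in_support:
  assumes s: "mixed_strategy (p, F)" and v: "continuous_on UNIV v"
    and AE: "AE x in interval_measure F. v x = (U::real)" and b: "F b < 1"
  shows "\<exists>c\<ge>b. F c = F b \<and> v c = U"
proof -
  interpret real_distribution "interval_measure F"
    by (rule real_distribution_mixed_strategy[OF s])
  note F = mixed_strategyD[OF s]
  define S where "S = {x\<in>{b..}. v x = U}"
  \<comment> \<open>Otherwise almost all bids are at most \<open>b\<close>, against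
    \<open>F b < 1\<close>.\<close>
  have "S \<noteq> {}"
  proof
    assume "S = {}"
    with AE have "AE x in interval_measure F. x \<le> b"
      by (auto simp: S_def intro: linear elim!: eventually_mono) (metis linear)
    then have "prob {..b} = 1"
      using prob_eq_1[of "{..b}"] by simp
    then show False
      using emeasure_bid_le[OF s, of b] b by (simp add: emeasure_eq_measure mixed_strategy_cdf_bounds[OF s])
  qed
  moreover have bdd: "bdd_below S"
    by (auto simp: S_def)
  moreover have "closed S"
    unfolding S_def using continuous_on_subset[OF v]
    by (intro continuous_closed_preimage_constant) auto
  ultimately have c: "Inf S \<in> S"
    by (rule closed_contains_Inf)
  have "AE x in interval_measure F. x \<in> {..<Inf S} \<longrightarrow> x \<in> {..b}"
    using AE
  proof eventually_elim
    case (elim x)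
    have "x \<in> S" if "b < x"
      using that elim by (simp add: S_def)
    then show ?case
      using cInf_lower[OF _ bdd, of x] by force
  qed
  then have "emeasure (interval_measure F) {..<Inf S} \<le> emeasure (interval_measure F) {..b}"
    by (intro emeasure_mono_AE) auto
  then have "F (Inf S) \<le> F b"
    using mixed_strategy_cdf_bounds[OF s] by (simp add: emeasure_bid_le[OF s] emeasure_bid_less[OF s])
  moreover have "F b \<le> F (Inf S)"
    using c by (intro monoD[OF F(3)]) (simp add: S_def)
  ultimately show ?thesis
    using c by (intro exI[of _ "Inf S"]) (simp add: S_def)
qed

section \<open>Indifference in a symmetric equilibrium\<close>

context auction
begin

lemma expected_payoff_abstain:
  assumes s: "mixed_strategy s" and s': "mixed_strategy (1, F')" and i: "i < N"
  shows "expected_payoff N V g r1 r2 ((\<lambda>_. s)(i := (1, F'))) i = 0"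
  unfolding expected_payoff_def nn_integral_payoff_deviation_parts[OF s s' i]
  by simp

text \<open>If the bid \<open>x\<close> were worth more than the equilibrium payoff, then by
  continuity so would all bids slightly above \<open>x\<close>, and bidding uniformly among them
  would be a profitable deviation.\<close>

lemma nash_imp_bid_value_le:
  assumes nash: "nash_equilibrium N V g r1 r2 (\<lambda>_. s)" and x: "0 \<le> x"
  shows "ereal (u s x) \<le> expected_payoff N V g r1 r2 (\<lambda>_. s) 0"
proof (rule ccontr)
  assume "\<not> ?thesis"
  then obtain c where c: "expected_payoff N V g r1 r2 (\<lambda>_. s) 0 < ereal c" "c < u s x"
    by (metis ereal_dense2 less_ereal.simps(1) not_le)
  have N0: "0 < N"
    using N by simp
  have s: "mixed_strategy s"
    using nash N0 by (auto simp: nash_equilibrium_def)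
  have cont: "continuous_on UNIV (u s)"
    by (rule continuous_bid_value[OF s])
  then have "isCont (u s) x"
    by (simp add: continuous_on_eq_continuous_at)
  then have "\<exists>d>0. \<forall>y. norm (y - x) < d \<longrightarrow> \<bar>u s y - u s x\<bar> < u s x - c"
    unfolding continuous_at_real_range using c(2) by simp
  then obtain d where d: "0 < d" "\<And>y. \<bar>y - x\<bar> < d \<Longrightarrow> \<bar>u s y - u s x\<bar> < u s x - c"
    by auto
  \<comment> \<open>Halving keeps the closed interval \<open>[x, x + e]\<close> inside the open
    neighbourhood where \<open>u s\<close> stays above \<open>c\<close>.\<close>
  define e where "e = d / 2"
  define F' where "F' = uniform_cdf x e"
  have e: "0 < e" "e < d"
    using d(1) by (simp_all add: e_def)
  have ge: "c \<le> u s y" if "x \<le> y" "y \<le> x + e" for y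
    using d(2)[of y] e that by (simp add: abs_if split: if_splits)
  have s': "mixed_strategy (0, F')"
    unfolding F'_def using x e by (intro mixed_strategy_uniform)
  interpret real_distribution "interval_measure F'"
    by (rule real_distribution_mixed_strategy[OF s'])
  have "F' x = 0" "F' (x + e) = 1"
    using e by (simp_all add: F'_def uniform_cdf_def)
  then have AE: "AE y in interval_measure F'. x < y" "AE y in interval_measure F'. y \<le> x + e"
    using AE_bid_ge[OF s'] AE_bid_le[OF s'] by auto
  note W = win_prob_bounds[OF s]
  \<comment> \<open>The loss is bounded on a bounded interval of bids, so the deviation's payoff is
    a real integral.\<close>
  have loss: "loss s y \<le> (x + e) + (r1 * g + r2 * (x + e))" if "x < y" "y \<le> x + e" for y
  proof -
    have "W s y * max 0 (- (V - g - y)) \<le> 1 * (x + e)"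
      using W V x e that by (intro mult_mono) auto
    moreover have "(1 - W s y) * (r1 * g + r2 * y) \<le> 1 * (r1 * g + r2 * (x + e))"
      using W x that g r1 r2 by (intro mult_mono add_left_mono mult_left_mono) auto
    ultimately show ?thesis
      by (simp add: bid_loss_def)
  qed
  have "(\<integral>\<^sup>+ b. ennreal (loss s b) \<partial>interval_measure F')
      \<le> (\<integral>\<^sup>+ b. ennreal ((x + e) + (r1 * g + r2 * (x + e))) \<partial>interval_measure F')"
  proof (rule nn_integral_mono_AE)
    show "AE b in interval_measure F'. ennreal (loss s b) \<le> ennreal ((x + e) + (r1 * g + r2 * (x + e)))"
      using AE by eventually_elim (intro ennreal_leI loss)
  qed
  also have "\<dots> < \<infinity>"
    using emeasure_space_1 by simp
  finally have fin: "(\<integral>\<^sup>+ b. ennreal (loss s b) \<partial>interval_measure F') < \<infinity>" .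
  note dev = expected_payoff_deviation_eq[OF s s' N0 fin]
  have "(\<integral>b. c \<partial>interval_measure F') \<le> (\<integral>b. u s b \<partial>interval_measure F')"
  proof (rule integral_mono_AE)
    show "AE b in interval_measure F'. c \<le> u s b"
      using AE by eventually_elim (simp add: ge)
  qed (use dev(1) in simp_all)
  then have "ereal c \<le> expected_payoff N V g r1 r2 ((\<lambda>_. s)(0 := (0, F'))) 0"
    using dev(2) prob_space by simp
  also have "\<dots> \<le> expected_payoff N V g r1 r2 (\<lambda>_. s) 0"
    using nash s' N0 by (simp add: nash_equilibrium_def)
  finally show False
    using c(1) by simp
qed

text \<open>The payoff \<open>U\<close> is \<open>1 - p\<close> times the mean of \<open>u\<close>
  under \<open>F\<close>, and \<open>u\<close> never exceeds \<open>U\<close>. This forces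
  \<open>p * U = 0\<close> and makes the mean equal to \<open>U\<close>; a nonnegative function
  \<open>U - u\<close> with mean zero vanishes almost surely.\<close>

lemma nash_imp_indifferent:
  assumes nash: "nash_equilibrium N V g r1 r2 (\<lambda>_. (p, F))"
  obtains U where "p < 1" "0 \<le> U" "p * U = 0" "\<And>x. 0 \<le> x \<Longrightarrow> u (p, F) x \<le> U"
    "AE x in interval_measure F. u (p, F) x = U"
proof -
  have N0: "0 < N"
    using N by simp
  have s: "mixed_strategy (p, F)"
    using nash N0 by (auto simp: nash_equilibrium_def)
  note p = mixed_strategyD(1,2)[OF s]
  define E where "E = expected_payoff N V g r1 r2 (\<lambda>_. (p, F)) 0"
  have upd: "(\<lambda>_. (p, F))(0 := (p, F)) = (\<lambda>_::nat. (p, F))"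
    by auto
  have abstain: "mixed_strategy (1, F)"
    using s by (simp add: mixed_strategy_def)
  have "0 \<le> E"
    using nash abstain N0 expected_payoff_abstain[OF s abstain N0]
    unfolding nash_equilibrium_def E_def by metis
  have le: "ereal (u (p, F) x) \<le> E" if "0 \<le> x" for x
    unfolding E_def by (rule nash_imp_bid_value_le[OF nash that])
  \<comment> \<open>If everybody abstained, the bid \<open>0\<close> would win for sure and earn
    \<open>V - g > 0\<close>.\<close>
  have "p \<noteq> 1"
  proof
    assume "p = 1"
    then have "E = 0"
      using expected_payoff_abstain[OF s abstain N0] upd by (simp add: E_def)
    moreover have "u (p, F) 0 = V - g"
      using \<open>p = 1\<close> by (simp add: bid_value_def win_prob_def)
    ultimately show False
      using le[of 0] V by (simp add: zero_ereal_def)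
  qed
  then have p1: "p < 1"
    using p by simp
  \<comment> \<open>An infinite expected loss would mean payoff minus infinity, while abstaining
    guarantees \<open>0\<close>.\<close>
  have fin: "(\<integral>\<^sup>+ b. ennreal (loss (p, F) b) \<partial>interval_measure F) < \<infinity>"
  proof (rule ccontr)
    assume "\<not> ?thesis"
    then have "ennreal (1 - p) * (\<integral>\<^sup>+ b. ennreal (loss (p, F) b) \<partial>interval_measure F) = \<infinity>"
      using p1 by (simp add: ennreal_mult_eq_top_iff less_top[symmetric])
    moreover obtain a where "0 \<le> a"
        "ennreal (1 - p) * (\<integral>\<^sup>+ b. ennreal (gain (p, F) b) \<partial>interval_measure F) = ennreal a"
      using nn_integral_gain_finite[OF s s]
      by (cases "ennreal (1 - p) * (\<integral>\<^sup>+ b. ennreal (gain (p, F) b) \<partial>interval_measure F)")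
        (auto simp: ennreal_mult_eq_top_iff)
    ultimately have "E = - \<infinity>"
      using nn_integral_payoff_deviation_parts[OF s s N0]
      unfolding E_def expected_payoff_def upd by (simp add: enn2ereal_ennreal)
    then show False
      using \<open>0 \<le> E\<close> by simp
  qed
  interpret real_distribution "interval_measure F"
    by (rule real_distribution_mixed_strategy[OF s])
  note dev = expected_payoff_deviation_eq[OF s s N0 fin, unfolded upd]
  define I where "I = (\<integral>b. u (p, F) b \<partial>interval_measure F)"
  define U where "U = (1 - p) * I"
  have E: "E = ereal U"
    unfolding E_def U_def I_def by (rule dev(2))
  have U: "0 \<le> U"
    using \<open>0 \<le> E\<close> by (simp add: E)
  have leU: "u (p, F) x \<le> U" if "0 \<le> x" for x
    using le[OF that] by (simp add: E)
  have AE: "AE x in interval_measure F. 0 \<le> U - u (p, F) x"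
    using AE_bid_pos[OF s] by eventually_elim (simp add: leU)
  have "0 \<le> (\<integral>x. U - u (p, F) x \<partial>interval_measure F)"
    using AE by (rule integral_nonneg_AE)
  moreover have int: "(\<integral>x. U - u (p, F) x \<partial>interval_measure F) = U - I"
    using dev(1) prob_space by (simp add: I_def)
  ultimately have "I \<le> U" by simp
  \<comment> \<open>The left side is \<open>U\<close>, so this reads
    \<open>U \<le> U - p * U\<close>.\<close>
  then have "(1 - p) * I \<le> (1 - p) * U"
    using p1 by (intro mult_left_mono) auto
  then have "p * U \<le> 0"
    by (simp add: U_def algebra_simps)
  then have pU: "p * U = 0"
    using mult_nonneg_nonneg[OF p(1) U] by linarith
  then have "(1 - p) * (U - I) = 0"
    by (simp add: U_def algebra_simps)
  then have "U - I = 0"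
    using p1 by simp
  then have "AE x in interval_measure F. U - u (p, F) x = 0"
    using integral_nonneg_eq_0_iff_AE[OF _ AE] dev(1) int by simp
  then have "AE x in interval_measure F. u (p, F) x = U"
    by eventually_elim simp
  then show ?thesis
    using that p1 U pU leU by blast
qed

end

section \<open>The equilibrium\<close>

text \<open>Base \<open>0\<close>, which occurs when \<open>r1 = 0\<close>, is a separate case
  because \<open>powr_realpow\<close> needs a positive base.\<close>

lemma powr_inverse_power_eq:
  assumes "0 \<le> (x::real)" "0 < n"
  shows "(x powr (1 / a)) ^ n = x powr (real n / a)"
proof (cases "x = 0")
  case False
  then show ?thesis
    using assms by (subst powr_realpow[symmetric]) (simp_all add: powr_powr)
qed (use assms in simp)

lemma powr_inverse_power:
  assumes "0 \<le> (x::real)" "0 < n"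
  shows "(x powr (1 / real n)) ^ n = x"
  using powr_inverse_power_eq[OF assms] assms by simp

lemma power_powr_inverse:
  assumes "0 \<le> (x::real)" "0 < n"
  shows "(x ^ n) powr (1 / real n) = x"
proof (cases "x = 0")
  case False
  then show ?thesis
    using assms by (simp add: powr_powr flip: powr_realpow)
qed (use assms in simp)

section \<open>The candidate strategy and its equilibrium property\<close>

context auction
begin

text \<open>The break-even winning probability: the value of \<open>W b\<close> at which
  \<open>u\<close> vanishes at \<open>b\<close>.\<close>

definition H :: "real \<Rightarrow> real" where
  "H b = (r1 * g + r2 * b) / (V - g - b + (r1 * g + r2 * b))"

definition pstar :: real where
  "pstar = (r1 * g / (V - g + r1 * g)) powr (1 / (real N - 1))"

text \<open>Clamping the bid to \<open>[0, V - g]\<close> extends the formula to a cdf on the whole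
  line.\<close>

definition Fstar :: "real \<Rightarrow> real" where
  "Fstar b = (H (max 0 (min b (V - g))) powr (1 / (real N - 1)) - pstar) / (1 - pstar)"

lemma real_N: "real N - 1 = real (N - 1)" "0 < N - 1"
  using N by auto

lemma H_denominator_pos:
  assumes "0 \<le> b" "b \<le> V - g"
  shows "0 < V - g - b + (r1 * g + r2 * b)"
proof (cases "b = 0")
  case True
  then show ?thesis
    using V penalty_nonneg[of 0] by simp
next
  case False
  then show ?thesis
    using assms penalty_pos[of b] by simp
qed

lemma H_bounds:
  assumes "0 \<le> b" "b \<le> V - g"
  shows "0 \<le> H b" "H b \<le> 1"
  using H_denominator_pos[OF assms] penalty_nonneg[OF assms(1)] assms by (auto simp: H_def)

text \<open>After cross-multiplication the mixed terms \<open>r2 * b * c\<close> cancel, leaving the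
  sum of two inequalities that are linear in the bid.\<close>

lemma H_mono:
  assumes "0 \<le> b" "b \<le> c" "c \<le> V - g"
  shows "H b \<le> H c"
proof -
  have "b * (r1 * g) \<le> c * (r1 * g)"
    using assms r1 g by (intro mult_right_mono) auto
  moreover have "b * (r2 * (V - g)) \<le> c * (r2 * (V - g))"
    using assms r2 V by (intro mult_right_mono) auto
  ultimately have "(r1 * g + r2 * b) * (V - g - c) \<le> (r1 * g + r2 * c) * (V - g - b)"
    by (simp add: algebra_simps)
  then show ?thesis
    using H_denominator_pos[of b] H_denominator_pos[of c] assms
    unfolding H_def by (simp add: divide_le_eq le_divide_eq algebra_simps)
qed

lemma H_0: "H 0 = r1 * g / (V - g + r1 * g)" and H_top: "H (V - g) = 1"
  using penalty_pos[of "V - g"] V by (simp_all add: H_def)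

lemma H_0_less: "H 0 < 1"
  using V H_denominator_pos[of 0] by (simp add: H_0)

lemma pstar_power: "pstar ^ (N - 1) = H 0"
  unfolding pstar_def H_0[symmetric] real_N(1)
  using H_bounds(1)[of 0] V real_N(2) by (intro powr_inverse_power) auto

lemma pstar_bounds: "0 \<le> pstar" "pstar < 1"
proof -
  show "0 \<le> pstar"
    by (simp add: pstar_def)
  show "pstar < 1"
  proof (rule ccontr)
    assume "\<not> pstar < 1"
    then have "1 \<le> pstar ^ (N - 1)"
      by (intro one_le_power) simp
    then show False
      using H_0_less unfolding pstar_power by simp
  qed
qed

lemma mixed_strategy_star: "mixed_strategy (pstar, Fstar)"
proof -
  have mono: "mono Fstar"
    unfolding Fstar_def
  proof (intro monoI divide_right_mono diff_right_mono powr_mono2 H_mono H_bounds)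
    show "0 \<le> 1 / (real N - 1)"
      using N by simp
  qed (use V pstar_bounds in auto)
  have clamp: "continuous_on UNIV (\<lambda>b. max 0 (min b (V - g)))"
    by (intro continuous_intros)
  have "continuous_on {0..V - g} H"
    unfolding H_def using H_denominator_pos
    by (intro continuous_intros) (metis atLeastAtMost_iff less_irrefl)
  then have "continuous_on UNIV (\<lambda>b. H (max 0 (min b (V - g))))"
    using V by (intro continuous_on_compose2[OF _ clamp]) auto
  \<comment> \<open>For \<open>r1 = 0\<close> the base of the power vanishes at nonpositive bids;
    the positive exponent gives continuity there.\<close>
  then have "continuous_on UNIV Fstar"
    unfolding Fstar_def
    using V N pstar_bounds(2) H_bounds(1) by (intro continuous_intros continuous_on_powr') auto
  moreover have "Fstar b = 0" if "b \<le> 0" for b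
    using that V by (simp add: Fstar_def pstar_def H_0)
  moreover have "(Fstar \<longlongrightarrow> 1) at_top"
  proof (rule tendsto_eventually)
    show "\<forall>\<^sub>F b in at_top. Fstar b = 1"
      using V pstar_bounds(2)
      by (auto simp: Fstar_def H_top eventually_at_top_linorder intro!: exI[of _ "V - g"])
  qed
  ultimately show ?thesis
    using mono pstar_bounds by (simp add: mixed_strategy_def)
qed

text \<open>Mixing in abstention undoes the normalization in \<open>Fstar\<close>, and the power
  \<open>N - 1\<close> undoes the root.\<close>

lemma win_prob_star: "W (pstar, Fstar) b = H (max 0 (min b (V - g)))"
proof -
  have "pstar + (1 - pstar) * Fstar b = H (max 0 (min b (V - g))) powr (1 / real (N - 1))"
    using pstar_bounds(2) real_N by (simp add: Fstar_def)
  then show ?thesis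
    unfolding win_prob_def fst_conv snd_conv
    using powr_inverse_power[OF H_bounds(1)[of "max 0 (min b (V - g))"] real_N(2)] V by simp
qed

text \<open>As a function of the winning probability the value is affine, with the denominator of
  \<open>H\<close> as slope; where that slope is positive, \<open>u\<close> vanishes exactly when
  \<open>W\<close> equals \<open>H\<close>.\<close>

lemma bid_value_alt: "u s b = W s b * (V - g - b + (r1 * g + r2 * b)) - (r1 * g + r2 * b)"
  by (simp add: bid_value_def algebra_simps)

lemma bid_value_star:
  assumes "0 \<le> b"
  shows "u (pstar, Fstar) b = (if b \<le> V - g then 0 else V - g - b)"
proof (cases "b \<le> V - g")
  case True
  then show ?thesis
    using H_denominator_pos[OF assms True] assms
    by (simp add: bid_value_alt win_prob_star H_def)
next
  case False
  then show ?thesis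
    using V by (simp add: bid_value_def win_prob_star H_top)
qed

lemma AE_bid_value_star: "AE b in interval_measure Fstar. u (pstar, Fstar) b = 0"
proof -
  have "Fstar (V - g) = 1"
    using V pstar_bounds(2) by (simp add: Fstar_def H_top)
  from AE_bid_le[OF mixed_strategy_star this] AE_bid_pos[OF mixed_strategy_star] show ?thesis
    by eventually_elim (simp add: bid_value_star)
qed

lemma nn_integral_loss_star:
  "(\<integral>\<^sup>+ b. ennreal (loss (pstar, Fstar) b) \<partial>interval_measure Fstar)
    = (\<integral>\<^sup>+ b. ennreal (gain (pstar, Fstar) b) \<partial>interval_measure Fstar)"
proof (rule nn_integral_cong_AE)
  show "AE b in interval_measure Fstar.
      ennreal (loss (pstar, Fstar) b) = ennreal (gain (pstar, Fstar) b)"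
    using AE_bid_value_star by eventually_elim (simp add: bid_value_eq)
qed

text \<open>No bid has positive value, so no deviation earns more than \<open>0\<close>; the profile
  itself earns \<open>0\<close> because its gain and loss have the same finite integral.\<close>

lemma nash_star: "nash_equilibrium N V g r1 r2 (\<lambda>_. (pstar, Fstar))"
  unfolding nash_equilibrium_def
proof (intro conjI allI impI)
  fix i s assume i: "i < N" and s: "mixed_strategy s"
  have upd: "(\<lambda>_. (pstar, Fstar))(i := (pstar, Fstar)) = (\<lambda>_::nat. (pstar, Fstar))"
    by auto
  have "expected_payoff N V g r1 r2 ((\<lambda>_. (pstar, Fstar))(i := (fst s, snd s))) i \<le> 0"
    using s i by (intro expected_payoff_deviation_le_0 mixed_strategy_star) (auto simp: bid_value_star)
  also have "0 = expected_payoff N V g r1 r2 (\<lambda>_. (pstar, Fstar)) i"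
  proof -
    obtain a where "0 \<le> a"
        "ennreal (1 - pstar) * (\<integral>\<^sup>+ b. ennreal (gain (pstar, Fstar) b) \<partial>interval_measure Fstar) = ennreal a"
      using nn_integral_gain_finite[OF mixed_strategy_star mixed_strategy_star]
      by (cases "ennreal (1 - pstar) * (\<integral>\<^sup>+ b. ennreal (gain (pstar, Fstar) b) \<partial>interval_measure Fstar)")
        (auto simp: ennreal_mult_eq_top_iff)
    then show ?thesis
      using nn_integral_payoff_deviation_parts[OF mixed_strategy_star mixed_strategy_star i]
      unfolding expected_payoff_def upd nn_integral_loss_star
      by (simp add: enn2ereal_ennreal)
  qed
  finally show "expected_payoff N V g r1 r2 ((\<lambda>_. (pstar, Fstar))(i := s)) i
      \<le> expected_payoff N V g r1 r2 (\<lambda>_. (pstar, Fstar)) i"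
    by simp
qed (rule mixed_strategy_star)

text \<open>Indifference at the bid \<open>0\<close> yields \<open>p\<close>; indifference at all
  bids below \<open>V - g\<close> yields \<open>F\<close>.\<close>

lemma nash_unique:
  assumes nash: "nash_equilibrium N V g r1 r2 (\<lambda>_. (p, F))"
  shows "(p, F) = (pstar, Fstar)"
proof -
  have s: "mixed_strategy (p, F)"
    using nash real_N(2) by (auto simp: nash_equilibrium_def dest: spec[of _ 0])
  note F = mixed_strategyD[OF s] mixed_strategy_cdf_bounds[OF s]
  obtain U where U: "p < 1" "0 \<le> U" "p * U = 0" "\<And>x. 0 \<le> x \<Longrightarrow> u (p, F) x \<le> U"
    "AE x in interval_measure F. u (p, F) x = U"
    using nash_imp_indifferent[OF nash] by blast
  let ?W = "W (p, F)"
  have W: "0 \<le> ?W b" "?W b \<le> 1" for b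
    using win_prob_bounds[OF s] by auto
  have W_cong: "?W b = ?W c" if "F b = F c" for b c
    using that by (simp add: win_prob_def)
  have support: "\<exists>c\<ge>b. ?W c = ?W b \<and> u (p, F) c = U" if "F b < 1" for b
    using first_bid_in_support[OF s continuous_bid_value[OF s] U(5) that] W_cong by metis
  have W0: "?W 0 = p ^ (N - 1)"
    by (simp add: win_prob_def F(5))
  have "u (p, F) 0 = U"
  proof -
    obtain c where c: "0 \<le> c" "?W c = ?W 0" "u (p, F) c = U"
      using support[of 0] F(5)[of 0] by auto
    \<comment> \<open>For \<open>c > 0\<close> the bid \<open>0\<close> wins equally often and pays
      no more. Since it cannot do better, \<open>W\<close> vanishes at \<open>0\<close> and
      \<open>r2 = 0\<close>; then \<open>U = - (r1 * g)\<close> is negative.\<close>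
    have "c = 0"
    proof (rule ccontr)
      assume "c \<noteq> 0"
      then have "0 < c" using c(1) by simp
      have "?W 0 * c + (1 - ?W 0) * (r2 * c) \<le> 0"
        using U(4)[of 0] c by (simp add: bid_value_def algebra_simps)
      moreover have "0 \<le> ?W 0 * c" "0 \<le> (1 - ?W 0) * (r2 * c)"
        using W[of 0] c(1) r2 by auto
      ultimately have "?W 0 * c = 0" "(1 - ?W 0) * (r2 * c) = 0"
        by linarith+
      then have "?W 0 = 0" "r2 = 0"
        using \<open>0 < c\<close> by auto
      then have "U = - (r1 * g)"
        using c by (simp add: bid_value_def)
      then show False
        using U(2) \<open>r2 = 0\<close> r12 r1 g by (auto simp: mult_le_0_iff)
    qed
    with c show ?thesis by simp
  qed
  then have u0: "U = p ^ (N - 1) * (V - g + r1 * g) - r1 * g"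
    by (simp add: bid_value_alt W0)
  \<comment> \<open>For \<open>p = 0\<close> the power \<open>p ^ (N - 1)\<close> is
    \<open>0\<close> because \<open>N - 1\<close> is positive, so \<open>U\<close> is at most
    \<open>0\<close>.\<close>
  have U0: "U = 0"
  proof (cases "p = 0")
    case True
    then have "U = - (r1 * g)"
      using u0 real_N by simp
    moreover have "0 \<le> r1 * g"
      using r1 g by simp
    ultimately show ?thesis
      using U(2) by linarith
  qed (use U(3) in simp)
  have "p ^ (N - 1) = r1 * g / (V - g + r1 * g)"
    using u0 U0 H_denominator_pos[of 0] V by (simp add: field_simps)
  then have p: "p = pstar"
    using power_powr_inverse[OF F(1) real_N(2)] by (simp add: pstar_def real_N(1))
  have less_1: "?W b < 1" if "F b < 1" for b
  proof -
    have "(1 - p) * F b < (1 - p) * 1"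
      using that U(1) by (intro mult_strict_left_mono) auto
    then have "p + (1 - p) * F b < 1" by simp
    moreover have "0 \<le> p + (1 - p) * F b"
      using accept_prob_bounds[OF s] by simp
    ultimately show ?thesis
      using real_N(2) unfolding win_prob_def by (auto intro: power_Suc_less_one power_less_one_iff[THEN iffD2])
  qed
  have neg: "u (p, F) c < 0" if "V - g \<le> c" "?W c < 1" for c
  proof -
    have "?W c * (V - g - c) \<le> 0"
      using W[of c] that by (intro mult_nonneg_nonpos) auto
    moreover have "0 < (1 - ?W c) * (r1 * g + r2 * c)"
      using that V by (intro mult_pos_pos penalty_pos) auto
    ultimately show ?thesis
      by (simp add: bid_value_def)
  qed
  \<comment> \<open>Otherwise some bid \<open>c \<ge> b\<close> would be worth \<open>0\<close>
    although it can lose and gains nothing by winning.\<close>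
  have F_top: "F b = 1" if b: "V - g \<le> b" for b
  proof (rule ccontr)
    assume "F b \<noteq> 1"
    then have "F b < 1"
      using F(11)[of b] by simp
    then obtain c where "b \<le> c" "?W c = ?W b" "u (p, F) c = 0"
      using support U0 by auto
    then show False
      using neg[of c] less_1[OF \<open>F b < 1\<close>] b by simp
  qed
  \<comment> \<open>No bid has positive value, so a failure means \<open>u < 0\<close> at
    \<open>b\<close>. The next bid \<open>c\<close> of value \<open>0\<close> has the same winning
    probability, but at constant winning probability the value cannot rise with the bid.\<close>
  have W_eq: "?W b = H b" if b: "0 \<le> b" "b < V - g" for b
  proof (rule ccontr)
    assume ne: "?W b \<noteq> H b"
    let ?R = "\<lambda>b. r1 * g + r2 * b"
    have "?W b * (V - g - b + ?R b) \<le> ?R b"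
      using U(4)[of b] U0 b by (simp add: bid_value_alt)
    moreover have "?W b * (V - g - b + ?R b) \<noteq> ?R b"
      using ne H_denominator_pos[of b] b by (auto simp: H_def field_simps)
    ultimately have less: "?W b * (V - g - b + ?R b) < ?R b" by simp
    \<comment> \<open>If \<open>F b = 1\<close>, the bid \<open>b\<close> wins for sure and earns
      \<open>V - g - b > 0\<close>.\<close>
    have "F b < 1"
    proof (rule ccontr)
      assume "\<not> F b < 1"
      then have "F b = 1" using F(11)[of b] by simp
      then show False
        using less b by (simp add: win_prob_def)
    qed
    then obtain c where c: "b \<le> c" "?W c = ?W b" "u (p, F) c = 0"
      using support U0 by auto
    have "?W b * (V - g - c + ?R c) = ?R c"
      using c by (simp add: bid_value_alt)
    with less have "(r2 * (1 - ?W b) + ?W b) * (c - b) < 0"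
      by (simp add: algebra_simps)
    moreover have "0 \<le> (r2 * (1 - ?W b) + ?W b) * (c - b)"
      using W[of b] r2 c(1) by (intro mult_nonneg_nonneg add_nonneg_nonneg) auto
    ultimately show False by simp
  qed
  have "F b = Fstar b" for b
  proof -
    consider "b \<le> 0" | "0 \<le> b" "b < V - g" | "V - g \<le> b" by linarith
    then show ?thesis
    proof cases
      case 1
      then show ?thesis
        using F(5) mixed_strategyD(5)[OF mixed_strategy_star] by simp
    next
      case 2
      have "p + (1 - p) * F b = ?W b powr (1 / real (N - 1))"
        using power_powr_inverse[OF accept_prob_bounds(1)[OF s] real_N(2)] by (simp add: win_prob_def)
      then show ?thesis
        using 2 U(1) W_eq[OF 2] by (simp add: Fstar_def real_N(1) p[symmetric] field_simps)
    next
      case 3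
      then show ?thesis
        using V pstar_bounds(2) by (simp add: F_top Fstar_def H_top)
    qed
  qed
  then show ?thesis
    using p by auto
qed

lemma equilibrium_strategy_eq: "equilibrium_strategy N V g r1 r2 = (pstar, Fstar)"
  unfolding equilibrium_strategy_def
proof (rule the_equality)
  show "nash_equilibrium N V g r1 r2 (\<lambda>_. (pstar, Fstar))"
    by (rule nash_star)
next
  fix s assume "nash_equilibrium N V g r1 r2 (\<lambda>_. s)"
  then show "s = (pstar, Fstar)"
    using nash_unique[of "fst s" "snd s"] by simp
qed

end

section \<open>Expected revenue\<close>

lemma emeasure_draws_PiE:
  assumes s: "mixed_strategy s" and A: "\<And>j. j < N \<Longrightarrow> A j \<in> sets (count_space UNIV \<Otimes>\<^sub>M borel)"
  shows "emeasure (draws N (\<lambda>_. s)) (Pi\<^sub>E {..<N} A) = (\<Prod>j<N. emeasure (draw s) (A j))"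
proof -
  interpret product_sigma_finite "\<lambda>_::nat. draw s"
    by (simp add: product_sigma_finite_def prob_space_imp_sigma_finite prob_space_draw s)
  show ?thesis
    unfolding draws_def using A by (intro emeasure_PiM) auto
qed

lemma space_draws: "space (draws N \<sigma>) = Pi\<^sub>E {..<N} (\<lambda>_. UNIV)"
  by (simp add: draws_def space_PiM)

lemma prob_space_draws: "mixed_strategy s \<Longrightarrow> prob_space (draws N (\<lambda>_. s))"
  unfolding draws_def by (intro prob_space_PiM prob_space_draw)

lemma emeasure_draw_coin:
  assumes s: "mixed_strategy (p, F)"
  shows "emeasure (draw (p, F)) {z. fst z = t} = ennreal (if t then 1 - p else p)"
    and "{z. fst z = t} \<in> sets (count_space UNIV \<Otimes>\<^sub>M (borel :: real measure))"
proof -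
  interpret real_distribution "interval_measure F"
    by (rule real_distribution_mixed_strategy[OF s])
  have "{z \<in> space (count_space UNIV \<Otimes>\<^sub>M borel). fst z = t} \<in> sets (count_space UNIV \<Otimes>\<^sub>M (borel :: real measure))"
    by measurable
  then show m: "{z. fst z = t} \<in> sets (count_space UNIV \<Otimes>\<^sub>M (borel :: real measure))"
    by (simp add: space_pair_measure)
  have "emeasure (draw (p, F)) {z. fst z = t} = (\<integral>\<^sup>+ z. indicator {z. fst z = t} z \<partial>draw (p, F))"
    using m by simp
  also have "\<dots> = ennreal (if t then 1 - p else p)"
    using m emeasure_space_1 by (subst nn_integral_draw[OF s]) (simp_all add: indicator_def)
  finally show "emeasure (draw (p, F)) {z. fst z = t} = ennreal (if t then 1 - p else p)" .
qed

lemma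
  assumes s: "mixed_strategy (p, F)" and i: "i < N"
  shows prob_participate: "measure (draws N (\<lambda>_. (p, F))) {\<omega> \<in> space (draws N (\<lambda>_. (p, F))). fst (\<omega> i)} = 1 - p"
    and sets_participate: "{\<omega> \<in> space (draws N (\<lambda>_. (p, F))). fst (\<omega> i)} \<in> sets (draws N (\<lambda>_. (p, F)))"
proof -
  interpret prob_space "draw (p, F)"
    by (rule prob_space_draw[OF s])
  define A :: "nat \<Rightarrow> (bool \<times> real) set" where "A j = (if j = i then {z. fst z = True} else UNIV)" for j
  have A: "z \<in> A j \<longleftrightarrow> j = i \<longrightarrow> fst z" for j z
    by (simp add: A_def)
  have eq: "{\<omega> \<in> space (draws N (\<lambda>_. (p, F))). fst (\<omega> i)} = Pi\<^sub>E {..<N} A"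
    unfolding set_eq_iff mem_Collect_eq space_draws PiE_iff A using i by blast
  have UNIV: "(UNIV :: (bool \<times> real) set) \<in> sets (count_space UNIV \<Otimes>\<^sub>M (borel :: real measure))"
    using sets.top[of "draw (p, F)"] by simp
  have "emeasure (draws N (\<lambda>_. (p, F))) (Pi\<^sub>E {..<N} A) = (\<Prod>j<N. emeasure (draw (p, F)) (A j))"
    using emeasure_draw_coin(2)[OF s, of True] UNIV by (intro emeasure_draws_PiE[OF s]) (auto simp: A_def)
  also have "\<dots> = (\<Prod>j<N. if j = i then ennreal (1 - p) else 1)"
    using emeasure_draw_coin(1)[OF s, of True] emeasure_space_1 by (intro prod.cong) (auto simp: A_def)
  also have "\<dots> = ennreal (1 - p)"
    using i by (simp add: prod.delta)
  finally show "measure (draws N (\<lambda>_. (p, F))) {\<omega> \<in> space (draws N (\<lambda>_. (p, F))). fst (\<omega> i)} = 1 - p"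
    using mixed_strategyD(2)[OF s] by (simp add: eq measure_def)
  show "{\<omega> \<in> space (draws N (\<lambda>_. (p, F))). fst (\<omega> i)} \<in> sets (draws N (\<lambda>_. (p, F)))"
    using measurable_draws_component(2)[OF i] by measurable
qed

text \<open>The event is a box on which every coin is \<open>False\<close>, so independence gives a
  product of \<open>N\<close> equal factors.\<close>

lemma
  assumes s: "mixed_strategy (p, F)"
  shows prob_nobody: "measure (draws N (\<lambda>_. (p, F))) {\<omega> \<in> space (draws N (\<lambda>_. (p, F))). \<forall>i<N. \<not> fst (\<omega> i)} = p ^ N"
    and sets_nobody: "{\<omega> \<in> space (draws N (\<lambda>_. (p, F))). \<forall>i<N. \<not> fst (\<omega> i)} \<in> sets (draws N (\<lambda>_. (p, F)))"
proof -
  let ?A = "\<lambda>_::nat. {z :: bool \<times> real. fst z = False}"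
  have eq: "{\<omega> \<in> space (draws N (\<lambda>_. (p, F))). \<forall>i<N. \<not> fst (\<omega> i)} = Pi\<^sub>E {..<N} ?A"
    unfolding set_eq_iff mem_Collect_eq space_draws PiE_iff by blast
  have "emeasure (draws N (\<lambda>_. (p, F))) (Pi\<^sub>E {..<N} ?A) = (\<Prod>j<N. ennreal p)"
    using emeasure_draw_coin[OF s, of False] by (subst emeasure_draws_PiE[OF s]) auto
  then show "measure (draws N (\<lambda>_. (p, F))) {\<omega> \<in> space (draws N (\<lambda>_. (p, F))). \<forall>i<N. \<not> fst (\<omega> i)} = p ^ N"
    using mixed_strategyD(1)[OF s] by (simp add: eq measure_def ennreal_power)
  show "{\<omega> \<in> space (draws N (\<lambda>_. (p, F))). \<forall>i<N. \<not> fst (\<omega> i)} \<in> sets (draws N (\<lambda>_. (p, F)))"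
    unfolding eq unfolding draws_def
    using emeasure_draw_coin(2)[OF s, of False] by (intro sets_PiM_I_finite) auto
qed

text \<open>There is one loser fewer than participants, unless nobody participates. This writes the
  base revenue as an affine combination of indicators, ready for linearity of expectation.\<close>

lemma base_revenue_actions:
  "base_revenue N g r1 (actions \<omega>) =
    (g - r1 * g) * (1 - of_bool (\<forall>i<N. \<not> fst (\<omega> i))) + (\<Sum>i<N. of_bool (fst (\<omega> i))) * (r1 * g)"
proof -
  let ?P = "participants N (actions \<omega>)"
  have P: "?P = {i\<in>{..<N}. fst (\<omega> i)}"
    by (auto simp: participants_def actions_def)
  then have card: "(\<Sum>i<N. of_bool (fst (\<omega> i))) = real (card ?P)"
    by (simp add: of_bool_def sum.If_cases Int_def)
  show ?thesis
  proof (cases "?P = {}")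
    case True
    then have "\<forall>i<N. \<not> fst (\<omega> i)" using P by auto
    then show ?thesis
      using True by (simp add: base_revenue_def)
  next
    case False
    then have "\<not> (\<forall>i<N. \<not> fst (\<omega> i))" using P by auto
    moreover have "card (losers N (actions \<omega>)) = card ?P - 1" "0 < card ?P"
      using winner_maximal[OF False] False by (simp_all add: losers_def card_gt_0_iff)
    ultimately show ?thesis
      using False by (simp add: base_revenue_def card of_nat_diff algebra_simps)
  qed
qed

text \<open>\<open>V\<close> occurs only on the right, where it cancels; rewriting with this
  equation therefore names \<open>V\<close> explicitly.\<close>

lemma revenue_actions:
  "revenue N g r1 r2 (actions \<omega>) =
    V * (1 - of_bool (\<forall>i<N. \<not> fst (\<omega> i))) - (\<Sum>i<N. payoff N V g r1 r2 (actions \<omega>) i)"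
proof -
  have "participants N (actions \<omega>) = {} \<longleftrightarrow> (\<forall>i<N. \<not> fst (\<omega> i))"
    by (auto simp: participants_def actions_def)
  then show ?thesis
    by (simp add: sum_payoff_eq)
qed

section \<open>Expected revenues in equilibrium\<close>

context auction
begin

abbreviation "D \<equiv> draws N (\<lambda>_. (pstar, Fstar))"

text \<open>The positive and the negative part of the payoff have the same finite integral.\<close>

lemma integral_payoff_star:
  assumes i: "i < N"
  shows "integrable D (\<lambda>\<omega>. payoff N V g r1 r2 (actions \<omega>) i)"
    and "(\<integral>\<omega>. payoff N V g r1 r2 (actions \<omega>) i \<partial>D) = 0"
proof -
  have upd: "(\<lambda>_. (pstar, Fstar))(i := (pstar, Fstar)) = (\<lambda>_::nat. (pstar, Fstar))"
    by auto
  note parts = nn_integral_payoff_deviation_parts[OF mixed_strategy_star mixed_strategy_star i,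
      unfolded upd nn_integral_loss_star]
  have fin: "ennreal (1 - pstar) * (\<integral>\<^sup>+ b. ennreal (gain (pstar, Fstar) b) \<partial>interval_measure Fstar) \<noteq> \<infinity>"
    using nn_integral_gain_finite[OF mixed_strategy_star mixed_strategy_star]
    by (auto simp: ennreal_mult_eq_top_iff)
  show int: "integrable D (\<lambda>\<omega>. payoff N V g r1 r2 (actions \<omega>) i)"
    unfolding real_integrable_def parts using fin measurable_payoff[OF i] by blast
  show "(\<integral>\<omega>. payoff N V g r1 r2 (actions \<omega>) i \<partial>D) = 0"
    unfolding real_lebesgue_integral_def[OF int] parts by simp
qed

lemma integral_somebody:
  "integrable D (\<lambda>\<omega>. 1 - of_bool (\<forall>i<N. \<not> fst (\<omega> i)) :: real)"
  "(\<integral>\<omega>. 1 - of_bool (\<forall>i<N. \<not> fst (\<omega> i)) \<partial>D) = 1 - pstar ^ N"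
proof -
  interpret prob_space D
    by (rule prob_space_draws[OF mixed_strategy_star])
  let ?S = "{\<omega> \<in> space D. \<forall>i<N. \<not> fst (\<omega> i)}"
  have S: "?S \<in> sets D"
    by (rule sets_nobody[OF mixed_strategy_star])
  have ind: "integrable D (\<lambda>\<omega>. indicator ?S \<omega> :: real)"
    using S by (auto simp: less_top[symmetric])
  have cong: "integrable D (\<lambda>\<omega>. 1 - of_bool (\<forall>i<N. \<not> fst (\<omega> i)) :: real)
      \<longleftrightarrow> integrable D (\<lambda>\<omega>. 1 - indicator ?S \<omega> :: real)"
    by (intro Bochner_Integration.integrable_cong) (auto simp: indicator_def)
  show "integrable D (\<lambda>\<omega>. 1 - of_bool (\<forall>i<N. \<not> fst (\<omega> i)) :: real)"
    unfolding cong using ind by (intro Bochner_Integration.integrable_diff) auto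
  have "(\<integral>\<omega>. 1 - of_bool (\<forall>i<N. \<not> fst (\<omega> i)) \<partial>D) = (\<integral>\<omega>. (1 :: real) - indicator ?S \<omega> \<partial>D)"
    by (intro Bochner_Integration.integral_cong) (auto simp: indicator_def)
  also have "\<dots> = (\<integral>\<omega>. (1 :: real) \<partial>D) - (\<integral>\<omega>. indicator ?S \<omega> \<partial>D)"
    using ind by (intro Bochner_Integration.integral_diff) auto
  also have "(\<integral>\<omega>. indicator ?S \<omega> \<partial>D) = measure D ?S"
    using S by (subst Bochner_Integration.integral_indicator) (simp add: Int_absorb2)
  also have "measure D ?S = pstar ^ N"
    by (rule prob_nobody[OF mixed_strategy_star])
  finally show "(\<integral>\<omega>. 1 - of_bool (\<forall>i<N. \<not> fst (\<omega> i)) \<partial>D) = 1 - pstar ^ N"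
    using prob_space by simp
qed

lemma integral_participates:
  assumes i: "i < N"
  shows "integrable D (\<lambda>\<omega>. of_bool (fst (\<omega> i)) :: real)"
    and "(\<integral>\<omega>. of_bool (fst (\<omega> i)) \<partial>D) = 1 - pstar"
proof -
  interpret prob_space D
    by (rule prob_space_draws[OF mixed_strategy_star])
  let ?S = "{\<omega> \<in> space D. fst (\<omega> i)}"
  have S: "?S \<in> sets D"
    by (rule sets_participate[OF mixed_strategy_star i])
  have cong: "integrable D (\<lambda>\<omega>. of_bool (fst (\<omega> i)) :: real)
      \<longleftrightarrow> integrable D (\<lambda>\<omega>. indicator ?S \<omega> :: real)"
    by (intro Bochner_Integration.integrable_cong) (auto simp: indicator_def)
  show "integrable D (\<lambda>\<omega>. of_bool (fst (\<omega> i)) :: real)"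
    unfolding cong using S by (auto simp: less_top[symmetric])
  have "(\<integral>\<omega>. of_bool (fst (\<omega> i)) \<partial>D) = (\<integral>\<omega>. (indicator ?S \<omega> :: real) \<partial>D)"
    by (intro Bochner_Integration.integral_cong) (auto simp: indicator_def)
  also have "\<dots> = measure D ?S"
    using S by (subst Bochner_Integration.integral_indicator) (simp add: Int_absorb2)
  also have "\<dots> = 1 - pstar"
    by (rule prob_participate[OF mixed_strategy_star i])
  finally show "(\<integral>\<omega>. of_bool (fst (\<omega> i)) \<partial>D) = 1 - pstar" .
qed

lemma integral_base_revenue:
  "integrable D (\<lambda>\<omega>. base_revenue N g r1 (actions \<omega>))"
  "(\<integral>\<omega>. base_revenue N g r1 (actions \<omega>) \<partial>D)
    = (1 - pstar ^ N) * g + ((1 - pstar) * real N - (1 - pstar ^ N)) * (r1 * g)"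
proof -
  have int: "integrable D (\<lambda>\<omega>. (g - r1 * g) * (1 - of_bool (\<forall>i<N. \<not> fst (\<omega> i))))"
    "integrable D (\<lambda>\<omega>. (\<Sum>i<N. of_bool (fst (\<omega> i))) * (r1 * g))"
    by (intro integrable_mult_right integral_somebody(1))
      (intro integrable_mult_left Bochner_Integration.integrable_sum integral_participates(1), simp)
  then show "integrable D (\<lambda>\<omega>. base_revenue N g r1 (actions \<omega>))"
    unfolding base_revenue_actions by (rule Bochner_Integration.integrable_add)
  have "(\<integral>\<omega>. (g - r1 * g) * (1 - of_bool (\<forall>i<N. \<not> fst (\<omega> i))) \<partial>D) = (g - r1 * g) * (1 - pstar ^ N)"
    unfolding integral_mult_right_zero integral_somebody(2) ..
  moreover have "(\<integral>\<omega>. (\<Sum>i<N. of_bool (fst (\<omega> i))) * (r1 * g) \<partial>D) = (\<Sum>i<N. 1 - pstar) * (r1 * g)"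
    unfolding integral_mult_left_zero
    by (subst Bochner_Integration.integral_sum) (simp_all add: integral_participates)
  ultimately show "(\<integral>\<omega>. base_revenue N g r1 (actions \<omega>) \<partial>D)
      = (1 - pstar ^ N) * g + ((1 - pstar) * real N - (1 - pstar ^ N)) * (r1 * g)"
    unfolding base_revenue_actions Bochner_Integration.integral_add[OF int]
    by (simp add: algebra_simps)
qed

lemma integral_revenue:
  "integrable D (\<lambda>\<omega>. revenue N g r1 r2 (actions \<omega>))"
  "(\<integral>\<omega>. revenue N g r1 r2 (actions \<omega>) \<partial>D) = (1 - pstar ^ N) * V"
proof -
  have int: "integrable D (\<lambda>\<omega>. V * (1 - of_bool (\<forall>i<N. \<not> fst (\<omega> i))))"
    "integrable D (\<lambda>\<omega>. \<Sum>i<N. payoff N V g r1 r2 (actions \<omega>) i)"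
    by (intro integrable_mult_right integral_somebody(1))
      (intro Bochner_Integration.integrable_sum integral_payoff_star(1), simp)
  then show "integrable D (\<lambda>\<omega>. revenue N g r1 r2 (actions \<omega>))"
    unfolding revenue_actions[of N g r1 r2 _ V] by (rule Bochner_Integration.integrable_diff)
  have "(\<integral>\<omega>. V * (1 - of_bool (\<forall>i<N. \<not> fst (\<omega> i))) \<partial>D) = V * (1 - pstar ^ N)"
    unfolding integral_mult_right_zero integral_somebody(2) ..
  moreover have "(\<integral>\<omega>. (\<Sum>i<N. payoff N V g r1 r2 (actions \<omega>) i) \<partial>D) = 0"
    by (subst Bochner_Integration.integral_sum) (simp_all add: integral_payoff_star)
  ultimately show "(\<integral>\<omega>. revenue N g r1 r2 (actions \<omega>) \<partial>D) = (1 - pstar ^ N) * V"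
    unfolding revenue_actions[of N g r1 r2 _ V] Bochner_Integration.integral_diff[OF int] by simp
qed

lemma equilibrium_draws_eq: "equilibrium_draws N V g r1 r2 = D"
  by (simp add: equilibrium_draws_def equilibrium_strategy_eq)

lemma expected_revenue_eq: "expected_revenue N V g r1 r2 = (1 - pstar ^ N) * V"
  by (simp add: expected_revenue_def equilibrium_draws_eq integral_revenue)

lemma expected_base_revenue_eq:
  "expected_base_revenue N V g r1 r2
    = (1 - pstar ^ N) * g + ((1 - pstar) * real N - (1 - pstar ^ N)) * (r1 * g)"
  by (simp add: expected_base_revenue_def equilibrium_draws_eq integral_base_revenue)

text \<open>Treating the priority revenue as a difference of two integrable functions avoids
  computing with the highest bid.\<close>

lemma expected_revenue_decompose:
  "expected_revenue N V g r1 r2 = expected_base_revenue N V g r1 r2 + expected_priority_revenue N V g r1 r2"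
proof -
  have "(\<lambda>\<omega>. priority_revenue N r2 (actions \<omega>))
      = (\<lambda>\<omega>. revenue N g r1 r2 (actions \<omega>) - base_revenue N g r1 (actions \<omega>))"
    by (simp add: revenue_def)
  then show ?thesis
    by (simp add: expected_revenue_def expected_base_revenue_def expected_priority_revenue_def
        equilibrium_draws_eq Bochner_Integration.integral_diff integral_revenue(1) integral_base_revenue(1))
qed

lemma pstar_power_N:
  "pstar ^ N = (r1 * g / (V - g + r1 * g)) powr (real N / (real N - 1))"
  using powr_inverse_power_eq[of "H 0" N "real N - 1"] H_bounds(1)[of 0] V N by (simp add: pstar_def H_0)

end

section \<open>Dependence on the parameters and limits for many agents\<close>

theorem theorem4p1:
  fixes N :: nat and V g r1 r2 pstar :: real
  assumes "N \<ge> 2" and "g > 0" and "V > g"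
    and "r1 \<in> {0..1}" and "r2 \<in> {0..1}" and "r1 \<noteq> 0 \<or> r2 \<noteq> 0"
    and pstar: "pstar = (r1 * g / (V - g + r1 * g)) powr (1 / (real N - 1))"
  shows
    "\<comment> \<open>(1)\<close>
     (expected_revenue N V g r1 r2 = (1 - pstar ^ N) * V
      \<and> (1 - pstar ^ N) * V
          = (1 - (r1 * g / (V - g + r1 * g)) powr (real N / (real N - 1))) * V)
    \<and> \<comment> \<open>(2)\<close>
     (strict_antimono_on {r \<in> {0..1}. r \<noteq> 0 \<or> r2 \<noteq> 0} (\<lambda>r. expected_revenue N V g r r2)
      \<and> (r1 = 0 \<longrightarrow> (\<lambda>n. expected_revenue n V g r1 r2) constant_on {2..})
      \<and> (r1 \<noteq> 0 \<longrightarrow> strict_antimono_on {2..} (\<lambda>n. expected_revenue n V g r1 r2))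
      \<and> (\<lambda>r. expected_revenue N V g r1 r) constant_on {r \<in> {0..1}. r1 \<noteq> 0 \<or> r \<noteq> 0})
    \<and> \<comment> \<open>(3)\<close>
     (expected_revenue N V g r1 r2
        = expected_base_revenue N V g r1 r2 + expected_priority_revenue N V g r1 r2
      \<and> expected_base_revenue N V g r1 r2
        = (1 - pstar ^ N) * g + ((1 - pstar) * real N - (1 - pstar ^ N)) * (r1 * g)
      \<and> expected_priority_revenue N V g r1 r2
        = (1 - pstar ^ N) * (V - g) - ((1 - pstar) * real N - (1 - pstar ^ N)) * (r1 * g))
    \<and> \<comment> \<open>(4)\<close>
     (r1 \<noteq> 0 \<longrightarrow>
        (\<lambda>n. expected_revenue n V g r1 r2) \<longlonglongrightarrow> V * (V - g) / (V - g + r1 * g)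
      \<and> (\<lambda>n. expected_base_revenue n V g r1 r2) \<longlonglongrightarrow>
          (V - g) * (g - r1 * g) / (V - g + r1 * g) + r1 * g * ln (1 + (V - g) / (r1 * g))
      \<and> (\<lambda>n. expected_priority_revenue n V g r1 r2) \<longlonglongrightarrow>
          (V - g) - r1 * g * ln (1 + (V - g) / (r1 * g)))"
proof -
  \<comment> \<open>This is \<open>pstar ^ (N - 1)\<close> at penalty rate \<open>r\<close>. It
    involves neither \<open>N\<close> nor \<open>r2\<close>, so \<open>N\<close> affects the
    expected revenue only through an exponent.\<close>
  define c where "c r = r * g / (V - g + r * g)" for r
  have auction: "auction n V g r s" if "2 \<le> n" "r \<in> {0..1}" "s \<in> {0..1}" "r \<noteq> 0 \<or> s \<noteq> 0" for n r s
    using assms that by unfold_locales auto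
  interpret auction N V g r1 r2
    using assms by (intro auction)
  have p: "auction.pstar N V g r1 = pstar"
    by (simp add: pstar pstar_def)
  have rev: "expected_revenue n V g r s = (1 - c r powr (real n / (real n - 1))) * V"
    if "2 \<le> n" "r \<in> {0..1}" "s \<in> {0..1}" "r \<noteq> 0 \<or> s \<noteq> 0" for n r s
    using auction.expected_revenue_eq[OF auction[OF that]] auction.pstar_power_N[OF auction[OF that]]
    by (simp add: c_def)
  have c0: "0 \<le> c r" if "0 \<le> r" for r
    using that assms(2,3) by (simp add: c_def)
  have c_less: "c r < c r'" if "0 \<le> r" "r < r'" for r r'
  proof -
    have "r * g * (V - g) < r' * g * (V - g)"
      using that assms(2,3) by simp
    moreover have "0 < V - g + r * g" "0 < V - g + r' * g"
      using that assms(2,3) by (simp_all add: add_pos_nonneg)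
    ultimately show ?thesis
      by (simp add: c_def divide_simps) (simp add: algebra_simps)
  qed
  have one: "expected_revenue N V g r1 r2 = (1 - pstar ^ N) * V
      \<and> (1 - pstar ^ N) * V
          = (1 - (r1 * g / (V - g + r1 * g)) powr (real N / (real N - 1))) * V"
    using expected_revenue_eq pstar_power_N by (simp add: p)
  have antimono_r1: "strict_antimono_on {r \<in> {0..1}. r \<noteq> 0 \<or> r2 \<noteq> 0} (\<lambda>r. expected_revenue N V g r r2)"
  proof (rule monotone_onI)
    fix r r' :: real
    assume r: "r \<in> {r \<in> {0..1}. r \<noteq> 0 \<or> r2 \<noteq> 0}" "r' \<in> {r \<in> {0..1}. r \<noteq> 0 \<or> r2 \<noteq> 0}" "r < r'"
    have "c r powr (real N / (real N - 1)) < c r' powr (real N / (real N - 1))"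
      using r assms(1) c0 c_less by (intro powr_less_mono2) auto
    then show "expected_revenue N V g r' r2 < expected_revenue N V g r r2"
      using r assms by (simp add: rev)
  qed
  \<comment> \<open>Here \<open>c 0 = 0\<close>, and \<open>0 powr\<close> any exponent is
    \<open>0\<close>.\<close>
  have const_N: "(\<lambda>n. expected_revenue n V g r1 r2) constant_on {2..}" if "r1 = 0"
    unfolding constant_on_def using assms that by (auto simp: rev c_def)
  have antimono_N: "strict_antimono_on {2..} (\<lambda>n. expected_revenue n V g r1 r2)" if "r1 \<noteq> 0"
  proof (rule monotone_onI)
    fix m n :: nat
    assume mn: "m \<in> {2..}" "n \<in> {2..}" "m < n"
    have "0 < c r1" "c r1 < 1"
      using assms that by (auto simp: c_def add_pos_nonneg)
    \<comment> \<open>The exponent is \<open>1 + 1 / (n - 1)\<close>, hence decreasing in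
      \<open>n\<close>; with a base strictly between \<open>0\<close> and \<open>1\<close> the power
      increases.\<close>
    moreover have "real n / (real n - 1) < real m / (real m - 1)"
      using mn by (simp add: field_simps)
    ultimately have "c r1 powr (real m / (real m - 1)) < c r1 powr (real n / (real n - 1))"
      using mult_strict_right_mono_neg[of "real n / (real n - 1)" "real m / (real m - 1)" "ln (c r1)"]
      by (simp add: powr_def)
    then show "expected_revenue n V g r1 r2 < expected_revenue m V g r1 r2"
      using mn assms by (simp add: rev)
  qed
  have const_r2: "(\<lambda>r. expected_revenue N V g r1 r) constant_on {r \<in> {0..1}. r1 \<noteq> 0 \<or> r \<noteq> 0}"
    unfolding constant_on_def using assms by (auto simp: rev)
  have base: "expected_base_revenue N V g r1 r2
        = (1 - pstar ^ N) * g + ((1 - pstar) * real N - (1 - pstar ^ N)) * (r1 * g)"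
    using expected_base_revenue_eq by (simp add: p)
  have three: "expected_revenue N V g r1 r2
        = expected_base_revenue N V g r1 r2 + expected_priority_revenue N V g r1 r2
      \<and> expected_base_revenue N V g r1 r2
        = (1 - pstar ^ N) * g + ((1 - pstar) * real N - (1 - pstar ^ N)) * (r1 * g)
      \<and> expected_priority_revenue N V g r1 r2
        = (1 - pstar ^ N) * (V - g) - ((1 - pstar) * real N - (1 - pstar ^ N)) * (r1 * g)"
    using expected_revenue_decompose one base by (simp add: algebra_simps)
  have four: "(\<lambda>n. expected_revenue n V g r1 r2) \<longlonglongrightarrow> V * (V - g) / (V - g + r1 * g)
      \<and> (\<lambda>n. expected_base_revenue n V g r1 r2) \<longlonglongrightarrow>
          (V - g) * (g - r1 * g) / (V - g + r1 * g) + r1 * g * ln (1 + (V - g) / (r1 * g))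
      \<and> (\<lambda>n. expected_priority_revenue n V g r1 r2) \<longlonglongrightarrow>
          (V - g) - r1 * g * ln (1 + (V - g) / (r1 * g))" if r1: "r1 \<noteq> 0"
  proof -
    \<comment> \<open>The logarithm in the limits is \<open>- ln (c r1)\<close>; writing
      \<open>c r1 = exp (- l)\<close> reduces them to asymptotics of \<open>exp\<close>.\<close>
    define l where "l = ln (1 + (V - g) / (r1 * g))"
    have r1g: "0 < r1 * g" "0 < V - g + r1 * g"
      using assms r1 by (auto simp: add_pos_nonneg)
    have l: "0 < l"
    proof -
      have "0 < (V - g) / (r1 * g)"
        using r1g assms(3) by (intro divide_pos_pos) auto
      then show ?thesis
        unfolding l_def by (intro ln_gt_zero) simp
    qed
    have c: "c r1 = exp (- l)"
    proof -
      have "1 + (V - g) / (r1 * g) = inverse (c r1)"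
        using r1g r1 assms(2) by (simp add: c_def add_divide_distrib)
      moreover have "0 < c r1"
        using r1g by (simp add: c_def)
      ultimately show ?thesis
        by (simp add: l_def ln_inverse)
    qed
    have comp: "1 - c r1 = (V - g) / (V - g + r1 * g)"
      using r1g r1 assms(2) by (simp add: c_def field_simps)
    have lim_N: "(\<lambda>n. c r1 powr (real n / (real n - 1))) \<longlonglongrightarrow> c r1"
    proof -
      have "(\<lambda>n. exp (- l * (real n / (real n - 1)))) \<longlonglongrightarrow> exp (- l * 1)"
        by (intro tendsto_intros) real_asymp
      then show ?thesis
        by (simp add: c powr_def mult.commute)
    qed
    \<comment> \<open>The expected number of participants stays bounded: to first order
      \<open>1 - exp (- l / (n - 1))\<close> is \<open>l / n\<close>.\<close>
    have lim_p: "(\<lambda>n. (1 - c r1 powr (1 / (real n - 1))) * real n) \<longlonglongrightarrow> l"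
    proof -
      have "(\<lambda>n. (1 - exp (- l / (real n - 1))) * real n) \<longlonglongrightarrow> l"
        using l by real_asymp
      then show ?thesis
        by (simp add: c powr_def)
    qed
    \<comment> \<open>The closed forms hold only from two agents on, which suffices for
      limits.\<close>
    have ev: "\<forall>\<^sub>F n in sequentially. 2 \<le> (n::nat)"
      by (rule eventually_ge_at_top)
    have "(\<lambda>n. (1 - c r1 powr (real n / (real n - 1))) * V) \<longlonglongrightarrow> (1 - c r1) * V"
      by (intro tendsto_intros lim_N)
    moreover have "\<forall>\<^sub>F n in sequentially.
        (1 - c r1 powr (real n / (real n - 1))) * V = expected_revenue n V g r1 r2"
      using ev by eventually_elim (use assms in \<open>simp add: rev\<close>)
    ultimately have R: "(\<lambda>n. expected_revenue n V g r1 r2) \<longlonglongrightarrow> (1 - c r1) * V"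
      by (rule Lim_transform_eventually)
    have "(\<lambda>n. (1 - c r1 powr (real n / (real n - 1))) * g
        + ((1 - c r1 powr (1 / (real n - 1))) * real n
            - (1 - c r1 powr (real n / (real n - 1)))) * (r1 * g))
        \<longlonglongrightarrow> (1 - c r1) * g + (l - (1 - c r1)) * (r1 * g)"
      by (intro tendsto_intros lim_N lim_p)
    moreover have "\<forall>\<^sub>F n in sequentially. (1 - c r1 powr (real n / (real n - 1))) * g
        + ((1 - c r1 powr (1 / (real n - 1))) * real n
            - (1 - c r1 powr (real n / (real n - 1)))) * (r1 * g) = expected_base_revenue n V g r1 r2"
      using ev
    proof eventually_elim
      case (elim n)
      have a: "auction n V g r1 r2"
        using assms elim by (intro auction) auto
      show ?case
        unfolding auction.expected_base_revenue_eq[OF a] auction.pstar_power_N[OF a]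
        unfolding auction.pstar_def[OF a] c_def ..
    qed
    ultimately have B: "(\<lambda>n. expected_base_revenue n V g r1 r2)
        \<longlonglongrightarrow> (1 - c r1) * g + (l - (1 - c r1)) * (r1 * g)"
      by (rule Lim_transform_eventually)
    have "\<forall>\<^sub>F n in sequentially. expected_revenue n V g r1 r2 - expected_base_revenue n V g r1 r2
        = expected_priority_revenue n V g r1 r2"
      using ev
    proof eventually_elim
      case (elim n)
      have a: "auction n V g r1 r2"
        using assms elim by (intro auction) auto
      show ?case
        using auction.expected_revenue_decompose[OF a] by simp
    qed
    then have P: "(\<lambda>n. expected_priority_revenue n V g r1 r2)
        \<longlonglongrightarrow> (1 - c r1) * V - ((1 - c r1) * g + (l - (1 - c r1)) * (r1 * g))"
      by (rule Lim_transform_eventually[OF tendsto_diff[OF R B]])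
    \<comment> \<open>Collecting the multiples of \<open>1 - c r1\<close> in the priority limit
      gives exactly this product.\<close>
    have "(1 - c r1) * (V - g + r1 * g) = V - g"
      using r1g by (simp add: comp)
    then have e1: "(1 - c r1) * V - ((1 - c r1) * g + (l - (1 - c r1)) * (r1 * g)) = (V - g) - r1 * g * l"
      by (simp add: algebra_simps)
    have e2: "(1 - c r1) * g + (l - (1 - c r1)) * (r1 * g) = (1 - c r1) * (g - r1 * g) + r1 * g * l"
      by (simp add: algebra_simps)
    show ?thesis
      using R B[unfolded e2] P[unfolded e1] unfolding l_def[symmetric] comp by (simp add: mult.commute)
  qed
  show ?thesis
    using one antimono_r1 const_N antimono_N const_r2 three four by blast
qed

end
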